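(* Assume $c_I<c_F$. With $F^{-1}$ the generalized inverse of $F$, let $$l_1:=F^{-1}\left(\frac{c_F-c_F^-}{c_F^+-c_F^-}\right)\ (\text{when } c_F^+>c_F^-),$$ $$l_2:=\min\{l\ge0:\ (v-c_F^+)F(l-\overline p_F)+c_F^+F(l)\ge c_I\},$$ $$l_3:=\min\{l\ge l_1:\ c_F+(v-c_F^+)F(l-\overline p_F)-c_F^-(1-F(l))\ge c_I\},$$ $$l_4:=\min\{l\ge l_1+\overline p_F:\ (v-c_F^-)F(l-\overline p_F)+c_F^-F(l)\ge c_I\},$$ $$l_5:=\min\{l\ge0:\ (v-c_F^+)F(l-\overline p_F-\overline p_I)+c_F^+F(l-\overline p_I)\ge c_F\},$$ $$l_6:=\min\{l\ge0:\ (v-c_F^-)F(l-\overline p_F-\overline p_I)+c_F^-F(l-\overline p_I)\ge c_F\}$$ (with value $+\infty$ for $l_3$, $l_4$ if the minimization is infeasible). The expected system operating cost associated with the price-consistent merit-order dispatch solution is equal to that of the stochastic dispatch solution in any of the following cases: 1. $l_1\ge l_2$ and $0\le l\le\min(\overline p_I+l_1,\,l_5)$; 2. $\frac{c_F-c_F^-}{c_F^+-c_F^-}\ge\frac{c_I}{c_F^+}$ and $0\le l\le\overline p_I+l_1$, provided that $\overline p_F>\overline p_W$; 3. $l\notin(l_5,\ \overline p_W+\overline p_I+\overline p_F)$, if $c_F^+=c_F$; 4. $0\le l\le\overline p_I+\overline p_W$ or $l\ge\overline p_W+\overline p_I+\overline p_F$, if $c_F^+=c_F$ and $\overline p_F>\overline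 p_W$; 5. $c_F=c_F^+=c_F^-$. Furthermore, if $c_F=c_F^-$, $c_F^+-c_F>0$ and $F^{-1}(0)=0$, then the price-consistent conventional two-stage market does not deliver maximum cost-efficiency (i.e. the cost of its dispatch solution does not equal that of the stochastic dispatch solution) except for $l\ge\max(l_6,\,l_4+\overline p_I)$ when $l_3>\overline p_F$, and $l\ge\max(l_6,\,\overline p_F+\overline p_I)$ otherwise.
   Context: Stylized power system: transmission capacity is infinite; there are inflexible, flexible and stochastic generation technologies with capacities $\overline p_I>0$, $\overline p_F>0$, $\overline p_W>0$. The marginal costs of inflexible and flexible generation are $c_I>0$ and $c_F>0$; the marginal cost of stochastic production is zero. $c_F^+$ is the unit cost of upward regulation by the flexible capacity, $c_F^-$ the unit utility it gets from downward regulation. Demand $l\ge 0$ is inelastic and known; $v$ is the unit cost of involuntary load curtailment. It holds that $v>c_F^+\ge c_F\ge c_F^-\ge 0$. The stochastic production is a random variable $W$ on a probability space $(\Omega,\mathcal F,P)$ with values in $[0,\overline p_W]$, cumulative distribution function $F$ and density $f$; $W(\omega)$ is its realization and $\int_\Omega g(\omega)f(\omega)\,d\omega$ denotes the expectation of $g$. $\widehat p_W$ is the power production expected from the stochastic producers (a given cap). The generalized inverse is $F^{-1}(\alpha)=\inf\{x\in\mathbb R: F(x)\ge\alpha\}$, with $F^{-1}(0)$ understood as $\inf\{x: F(x)>0\}$. Stochastic dispatch solution: the forward dispatch of an optimal solution of the stochastic two-stage market (SM): minimize over $p_I,p_F,p_W$ and $p_F^+(\omega),p_F^-(\omega),\Delta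 p_W(\omega),s(\omega)$ $$c_Ip_I+c_Fp_F+\int_\Omega\left(v\,s(\omega)+c_F^+p_F^+(\omega)-c_F^-p_F^-(\omega)\right)f(\omega)\,d\omega$$ subject to $p_F+p_I+p_W-l=0$, $0\le p_F\le\overline p_F$, $0\le p_I\le\overline p_I$, and for all $\omega\in\Omega$: $s(\omega)+p_F^+(\omega)-p_F^-(\omega)+\Delta p_W(\omega)=0$, $0\le p_F^-(\omega)\le p_F$, $0\le p_F^+(\omega)\le\overline p_F-p_F$, $0\le p_W+\Delta p_W(\omega)\le W(\omega)$, $0\le s(\omega)\le l$. Its expected system operating cost is the optimal value of (SM), i.e. the maximum cost-efficiency. Price-consistent merit-order dispatch solution (price-consistent conventional two-stage market, with virtual bidding): a solution of the equilibrium problem (EQ): find $p_F,p_I,p_W,p_V$, $p_F^+(\omega),p_F^-(\omega),\Delta p_W(\omega),s(\omega),\Delta p_V(\omega)$ and prices $\lambda^f,\lambda^b(\omega)$ such that the optimality (KKT) conditions of the following three problems hold simultaneously. (i) Forward market, for given $p_V$: minimize $c_Fp_F+c_Ip_I$ over $p_F,p_I,p_W$ subject to $p_F+p_I+p_W+p_V=l$ (multiplier $\lambda^f$), $0\le p_W\le\widehat p_W$, $0\le p_F\le\overline p_F$, $0\le p_I\le\overline p_I$. (ii) Balancing market, for each $\omega\in\Omega$ and given $p_W,p_F,\Delta p_V(\omega)$: minimize $c_F^+p_F^+(\omega)-c_F^-p_F^-(\omega)+v\,s(\omega)$ over $p_F^+(\omega),p_F^-(\omega),\Delta p_W(\omega),s(\omega)$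 subject to $p_F^+(\omega)-p_F^-(\omega)+\Delta p_W(\omega)+\Delta p_V(\omega)+s(\omega)=0$ (multiplier $\lambda^b(\omega)$), $0\le p_F^+(\omega)\le\overline p_F-p_F$, $0\le p_F^-(\omega)\le p_F$, $0\le p_W+\Delta p_W(\omega)\le W(\omega)$, $0\le s(\omega)\le l$. (iii) Risk-neutral price-taking arbitrager, for given $\lambda^f,\lambda^b(\cdot)$: maximize $p_V\lambda^f+\int_\Omega\Delta p_V(\omega)\lambda^b(\omega)f(\omega)\,d\omega$ over $p_V,\Delta p_V(\cdot)$ (of any sign) subject to $p_V+\Delta p_V(\omega)=0$. Sign convention: $\lambda^f$ and $\lambda^b(\omega)$ are prices, i.e. the multipliers are signed so that they represent the marginal cost of serving additional load. The expected system operating cost of such a solution is $c_Ip_I+c_Fp_F+\int_\Omega(v\,s(\omega)+c_F^+p_F^+(\omega)-c_F^-p_F^-(\omega))f(\omega)\,d\omega$.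
   Formalization: If F is flat somewhere with 0<F<1, then in cases 1 and 3 at l=l_5 and in the exceptional range equality is claimed for some, not every, price-consistent solution; inefficiency is not claimed (equality is proved) at l=0 and for F^{-1}(1)+p_I ≤ l < p_F+p_I. *)

theory Defs
  imports "HOL-Probability.Probability"
begin

record power_system =
  cap_I :: real
  cap_F :: real
  cap_W :: real
  hat_W :: real   \<comment> \<open>cap on the stochastic production accepted by the conventional forward market\<close>
  c_I :: real
  c_F :: real
  c_up :: real    \<comment> \<open>unit cost of upward regulation\<close>
  c_dn :: real    \<comment> \<open>unit utility of downward regulation\<close>
  voll :: real    \<comment> \<open>unit cost of involuntary load curtailment\<close>

definition valid_power_system :: "power_system \<Rightarrow> bool" where
  "valid_power_system S \<longleftrightarrow>
     0 < cap_I S \<and> 0 < cap_F S \<and> 0 < cap_W S \<and> 0 \<le> hat_W S \<and>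
     0 < c_I S \<and> 0 < c_F S \<and>
     c_up S < voll S \<and> c_F S \<le> c_up S \<and> c_dn S \<le> c_F S \<and> 0 \<le> c_dn S"

record 'a dispatch =
  fwd_I :: real
  fwd_F :: real
  fwd_W :: real
  up :: "'a \<Rightarrow> real"
  down :: "'a \<Rightarrow> real"
  adj_W :: "'a \<Rightarrow> real"
  shed :: "'a \<Rightarrow> real"

record 'a equilibrium = "'a dispatch" +
  virt :: real
  adj_virt :: "'a \<Rightarrow> real"
  price_fwd :: real
  price_bal :: "'a \<Rightarrow> real"

definition measurable_recourse :: "'a measure \<Rightarrow> ('a, 'b) dispatch_scheme \<Rightarrow> bool" where
  "measurable_recourse M d \<longleftrightarrow>
     up d \<in> borel_measurable M \<and> down d \<in> borel_measurable M \<and>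
     adj_W d \<in> borel_measurable M \<and> shed d \<in> borel_measurable M"

definition operating_cost :: "power_system \<Rightarrow> 'a measure \<Rightarrow> ('a, 'b) dispatch_scheme \<Rightarrow> real" where
  "operating_cost S M d =
     c_I S * fwd_I d + c_F S * fwd_F d +
     (\<integral>\<omega>. voll S * shed d \<omega> + c_up S * up d \<omega> - c_dn S * down d \<omega> \<partial>M)"


subsection \<open>Stochastic two-stage market\<close>

definition sm_feasible ::
    "power_system \<Rightarrow> 'a measure \<Rightarrow> ('a \<Rightarrow> real) \<Rightarrow> real \<Rightarrow> 'a dispatch \<Rightarrow> bool" where
  "sm_feasible S M W l d \<longleftrightarrow>
     measurable_recourse M d \<and>
     fwd_F d + fwd_I d + fwd_W d - l = 0 \<and>
     0 \<le> fwd_F d \<and> fwd_F d \<le> cap_F S \<and>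
     0 \<le> fwd_I d \<and> fwd_I d \<le> cap_I S \<and>
     (\<forall>\<omega>\<in>space M.
        shed d \<omega> + up d \<omega> - down d \<omega> + adj_W d \<omega> = 0 \<and>
        0 \<le> down d \<omega> \<and> down d \<omega> \<le> fwd_F d \<and>
        0 \<le> up d \<omega> \<and> up d \<omega> \<le> cap_F S - fwd_F d \<and>
        0 \<le> fwd_W d + adj_W d \<omega> \<and> fwd_W d + adj_W d \<omega> \<le> W \<omega> \<and>
        0 \<le> shed d \<omega> \<and> shed d \<omega> \<le> l)"

definition stochastic_solution ::
    "power_system \<Rightarrow> 'a measure \<Rightarrow> ('a \<Rightarrow> real) \<Rightarrow> real \<Rightarrow> 'a dispatch \<Rightarrow> bool" where
  "stochastic_solution S M W l d \<longleftrightarrow>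
     sm_feasible S M W l d \<and>
     (\<forall>d'. sm_feasible S M W l d' \<longrightarrow> operating_cost S M d \<le> operating_cost S M d')"


subsection \<open>Price-consistent conventional two-stage market\<close>

text \<open>The KKT conditions of a linear minimization attached to one variable \<open>x\<close> with bounds
  \<open>a \<le> x \<le> b\<close>; \<open>r\<close> is the derivative in \<open>x\<close> of the objective minus the price times the
  balance constraint, and \<open>\<mu>\<close>, \<open>\<nu>\<close> are the multipliers of the lower and upper bound.\<close>

definition kkt_bounded :: "real \<Rightarrow> real \<Rightarrow> real \<Rightarrow> real \<Rightarrow> bool" where
  "kkt_bounded r a x b \<longleftrightarrow>
     a \<le> x \<and> x \<le> b \<and>
     (\<exists>\<mu> \<nu>. 0 \<le> \<mu> \<and> 0 \<le> \<nu> \<and> r - \<mu> + \<nu> = 0 \<and> \<mu> * (x - a) = 0 \<and> \<nu> * (b - x) = 0)"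

definition forward_kkt :: "power_system \<Rightarrow> real \<Rightarrow> 'a equilibrium \<Rightarrow> bool" where
  "forward_kkt S l e \<longleftrightarrow>
     fwd_F e + fwd_I e + fwd_W e + virt e = l \<and>
     kkt_bounded (- price_fwd e) 0 (fwd_W e) (hat_W S) \<and>
     kkt_bounded (c_F S - price_fwd e) 0 (fwd_F e) (cap_F S) \<and>
     kkt_bounded (c_I S - price_fwd e) 0 (fwd_I e) (cap_I S)"

definition balancing_kkt ::
    "power_system \<Rightarrow> ('a \<Rightarrow> real) \<Rightarrow> real \<Rightarrow> 'a equilibrium \<Rightarrow> 'a \<Rightarrow> bool" where
  "balancing_kkt S W l e \<omega> \<longleftrightarrow>
     up e \<omega> - down e \<omega> + adj_W e \<omega> + adj_virt e \<omega> + shed e \<omega> = 0 \<and>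
     kkt_bounded (c_up S - price_bal e \<omega>) 0 (up e \<omega>) (cap_F S - fwd_F e) \<and>
     kkt_bounded (- c_dn S + price_bal e \<omega>) 0 (down e \<omega>) (fwd_F e) \<and>
     kkt_bounded (- price_bal e \<omega>) 0 (fwd_W e + adj_W e \<omega>) (W \<omega>) \<and>
     kkt_bounded (voll S - price_bal e \<omega>) 0 (shed e \<omega>) l"

definition arbitrage_feasible :: "'a measure \<Rightarrow> real \<Rightarrow> ('a \<Rightarrow> real) \<Rightarrow> bool" where
  "arbitrage_feasible M p q \<longleftrightarrow> (\<forall>\<omega>\<in>space M. p + q \<omega> = 0)"

definition arbitrage_profit ::
    "'a measure \<Rightarrow> real \<Rightarrow> ('a \<Rightarrow> real) \<Rightarrow> real \<Rightarrow> ('a \<Rightarrow> real) \<Rightarrow> real" where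
  "arbitrage_profit M lf lb p q = p * lf + (\<integral>\<omega>. q \<omega> * lb \<omega> \<partial>M)"

definition arbitrager_optimal :: "'a measure \<Rightarrow> 'a equilibrium \<Rightarrow> bool" where
  "arbitrager_optimal M e \<longleftrightarrow>
     arbitrage_feasible M (virt e) (adj_virt e) \<and>
     (\<forall>p q. arbitrage_feasible M p q \<longrightarrow>
        arbitrage_profit M (price_fwd e) (price_bal e) p q
          \<le> arbitrage_profit M (price_fwd e) (price_bal e) (virt e) (adj_virt e))"

definition price_consistent_solution ::
    "power_system \<Rightarrow> 'a measure \<Rightarrow> ('a \<Rightarrow> real) \<Rightarrow> real \<Rightarrow> 'a equilibrium \<Rightarrow> bool" where
  "price_consistent_solution S M W l e \<longleftrightarrow>
     measurable_recourse M e \<and> integrable M (price_bal e) \<and>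
     forward_kkt S l e \<and>
     (\<forall>\<omega>\<in>space M. balancing_kkt S W l e \<omega>) \<and>
     arbitrager_optimal M e"


subsection \<open>Comparison of the two markets\<close>

text \<open>Neither problem need have a unique solution.  All stochastic solutions have the same cost,
  but when \<open>F\<close> is constant on an interval where \<open>0 < F < 1\<close>, different solutions of the
  equilibrium problem can have different costs.  Hence a version for all equilibria, one for some
  equilibrium, and one for none.\<close>

definition solutions_exist ::
    "power_system \<Rightarrow> 'a measure \<Rightarrow> ('a \<Rightarrow> real) \<Rightarrow> real \<Rightarrow> bool" where
  "solutions_exist S M W l \<longleftrightarrow>
     (\<exists>e. price_consistent_solution S M W l e) \<and> (\<exists>d. stochastic_solution S M W l d)"

definition always_efficient ::
    "power_system \<Rightarrow> 'a measure \<Rightarrow> ('a \<Rightarrow> real) \<Rightarrow> real \<Rightarrow> bool" where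
  "always_efficient S M W l \<longleftrightarrow>
     solutions_exist S M W l \<and>
     (\<forall>e d. price_consistent_solution S M W l e \<and> stochastic_solution S M W l d \<longrightarrow>
        operating_cost S M e = operating_cost S M d)"

definition possibly_efficient ::
    "power_system \<Rightarrow> 'a measure \<Rightarrow> ('a \<Rightarrow> real) \<Rightarrow> real \<Rightarrow> bool" where
  "possibly_efficient S M W l \<longleftrightarrow>
     (\<exists>e d. price_consistent_solution S M W l e \<and> stochastic_solution S M W l d \<and>
        operating_cost S M e = operating_cost S M d)"

definition never_efficient ::
    "power_system \<Rightarrow> 'a measure \<Rightarrow> ('a \<Rightarrow> real) \<Rightarrow> real \<Rightarrow> bool" where
  "never_efficient S M W l \<longleftrightarrow>
     solutions_exist S M W l \<and>
     (\<forall>e d. price_consistent_solution S M W l e \<and> stochastic_solution S M W l d \<longrightarrow>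
        operating_cost S M e \<noteq> operating_cost S M d)"


subsection \<open>Demand thresholds\<close>

definition gen_inverse :: "(real \<Rightarrow> real) \<Rightarrow> real \<Rightarrow> real" where
  "gen_inverse F \<alpha> = (if \<alpha> = 0 then Inf {x. 0 < F x} else Inf {x. \<alpha> \<le> F x})"

definition crit_ratio :: "power_system \<Rightarrow> real" where
  "crit_ratio S = (c_F S - c_dn S) / (c_up S - c_dn S)"

text \<open>\<open>F\<close> is continuous here, so the infima below are minima whenever the set is nonempty; it is
  always nonempty for \<open>l2\<close>, \<open>l5\<close> and \<open>l6\<close>.  \<open>l1\<close>, hence also \<open>l3\<close> and \<open>l4\<close>,
  is meaningful only for \<open>c_dn S < c_up S\<close>.\<close>

definition l1 :: "power_system \<Rightarrow> (real \<Rightarrow> real) \<Rightarrow> real" where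
  "l1 S F = gen_inverse F (crit_ratio S)"

definition l2 :: "power_system \<Rightarrow> (real \<Rightarrow> real) \<Rightarrow> real" where
  "l2 S F = Inf {l. 0 \<le> l \<and> (voll S - c_up S) * F (l - cap_F S) + c_up S * F l \<ge> c_I S}"

definition l3 :: "power_system \<Rightarrow> (real \<Rightarrow> real) \<Rightarrow> ereal" where
  "l3 S F = Inf (ereal ` {l. l1 S F \<le> l \<and>
     c_F S + (voll S - c_up S) * F (l - cap_F S) - c_dn S * (1 - F l) \<ge> c_I S})"

definition l4 :: "power_system \<Rightarrow> (real \<Rightarrow> real) \<Rightarrow> ereal" where
  "l4 S F = Inf (ereal ` {l. l1 S F + cap_F S \<le> l \<and>
     (voll S - c_dn S) * F (l - cap_F S) + c_dn S * F l \<ge> c_I S})"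

definition l5 :: "power_system \<Rightarrow> (real \<Rightarrow> real) \<Rightarrow> real" where
  "l5 S F = Inf {l. 0 \<le> l \<and>
     (voll S - c_up S) * F (l - cap_F S - cap_I S) + c_up S * F (l - cap_I S) \<ge> c_F S}"

definition l6 :: "power_system \<Rightarrow> (real \<Rightarrow> real) \<Rightarrow> real" where
  "l6 S F = Inf {l. 0 \<le> l \<and>
     (voll S - c_dn S) * F (l - cap_F S - cap_I S) + c_dn S * F (l - cap_I S) \<ge> c_F S}"

definition case1 :: "power_system \<Rightarrow> (real \<Rightarrow> real) \<Rightarrow> real \<Rightarrow> bool" where
  "case1 S F l \<longleftrightarrow> c_dn S < c_up S \<and> l2 S F \<le> l1 S F \<and>
     0 \<le> l \<and> l \<le> min (cap_I S + l1 S F) (l5 S F)"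

definition case2 :: "power_system \<Rightarrow> (real \<Rightarrow> real) \<Rightarrow> real \<Rightarrow> bool" where
  "case2 S F l \<longleftrightarrow> c_dn S < c_up S \<and> c_I S / c_up S \<le> crit_ratio S \<and>
     0 \<le> l \<and> l \<le> cap_I S + l1 S F \<and> cap_W S < cap_F S"

definition case3 :: "power_system \<Rightarrow> (real \<Rightarrow> real) \<Rightarrow> real \<Rightarrow> bool" where
  "case3 S F l \<longleftrightarrow> c_up S = c_F S \<and> l \<notin> {l5 S F <..< cap_W S + cap_I S + cap_F S}"

definition case4 :: "power_system \<Rightarrow> real \<Rightarrow> bool" where
  "case4 S l \<longleftrightarrow> c_up S = c_F S \<and> cap_W S < cap_F S \<and>
     (0 \<le> l \<and> l \<le> cap_I S + cap_W S \<or> cap_W S + cap_I S + cap_F S \<le> l)"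

definition case5 :: "power_system \<Rightarrow> bool" where
  "case5 S \<longleftrightarrow> c_F S = c_up S \<and> c_up S = c_dn S"

definition exceptional_demand :: "power_system \<Rightarrow> (real \<Rightarrow> real) \<Rightarrow> real \<Rightarrow> bool" where
  "exceptional_demand S F l \<longleftrightarrow>
     (if ereal (cap_F S) < l3 S F
      then max (ereal (l6 S F)) (l4 S F + ereal (cap_I S)) \<le> ereal l
      else max (l6 S F) (cap_F S + cap_I S) \<le> l)"

text \<open>Demand levels with \<open>c_dn S = c_F S\<close> at which both markets have the same cost although
  \<open>exceptional_demand\<close> fails: no demand at all, or demand that, after full inflexible production,
  exceeds every stochastic output but not the flexible capacity, so that the flexible units are
  regulated downwards almost surely and at no loss.\<close>

definition degenerate_demand :: "power_system \<Rightarrow> (real \<Rightarrow> real) \<Rightarrow> real \<Rightarrow> bool" where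
  "degenerate_demand S F l \<longleftrightarrow>
     l = 0 \<or> gen_inverse F 1 + cap_I S \<le> l \<and> l < cap_F S + cap_I S"

definition no_plateau :: "(real \<Rightarrow> real) \<Rightarrow> bool" where
  "no_plateau F \<longleftrightarrow> strict_mono_on {x. 0 < F x \<and> F x < 1} F"

end

theory Submission
  imports Defs
begin

text \<open>Fix the forward quantities \<open>x\<close> (flexible) and \<open>y\<close> (inflexible), and let \<open>D = l - y\<close>.  Both
  markets then settle the balancing stage at the same minimal cost, and as \<open>W\<close> has no atoms the
  balancing price is almost surely determined when \<open>D > 0\<close>; its mean is \<open>mean_price x D\<close>.  Absence
  of arbitrage makes this mean the forward price, so equilibria are the points satisfying the
  forward KKT conditions at that price.  The total cost is convex in \<open>(x, y)\<close>, with subgradient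
  \<open>(slope x D, c_I - mean_price x D)\<close>.  The conditions in \<open>y\<close> hence agree in both markets, and an
  equilibrium is efficient iff it satisfies the optimality condition in \<open>x\<close> expressed through
  \<open>slope\<close>.  Since \<open>c_I < c_F\<close>, flexible forward production is positive only when \<open>y\<close> is at capacity;
  the demand thresholds translate the condition on \<open>slope\<close> into conditions on \<open>l\<close>.\<close>

section \<open>Optimality conditions, arbitrage and superlevel sets\<close>

text \<open>Complementary slackness kills \<open>\<nu>\<close> when \<open>x < b\<close> and
  \<open>\<mu>\<close> when \<open>a < x\<close>, which fixes the sign of \<open>r\<close>;
  conversely the positive and negative parts of \<open>r\<close> are multipliers. For
  \<open>a = b\<close> the sign stays free.\<close>

lemma kkt_bounded_iff:
  "kkt_bounded r a x b \<longleftrightarrow>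
     a \<le> x \<and> x \<le> b \<and> (x < b \<longrightarrow> 0 \<le> r) \<and> (a < x \<longrightarrow> r \<le> 0)"
proof
  assume "kkt_bounded r a x b"
  then obtain \<mu> \<nu> where "a \<le> x" "x \<le> b" "0 \<le> \<mu>" "0 \<le> \<nu>" "r - \<mu> + \<nu> = 0"
    "\<mu> * (x - a) = 0" "\<nu> * (b - x) = 0"
    unfolding kkt_bounded_def by blast
  then show "a \<le> x \<and> x \<le> b \<and> (x < b \<longrightarrow> 0 \<le> r) \<and> (a < x \<longrightarrow> r \<le> 0)"
    by auto
next
  assume "a \<le> x \<and> x \<le> b \<and> (x < b \<longrightarrow> 0 \<le> r) \<and> (a < x \<longrightarrow> r \<le> 0)"
  moreover from this have "max 0 r * (x - a) = 0" "max 0 (- r) * (b - x) = 0"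
    by (cases "a < x"; cases "x < b"; auto simp: max_def)+
  ultimately show "kkt_bounded r a x b"
    unfolding kkt_bounded_def
    by (intro conjI exI[of _ "max 0 r"] exI[of _ "max 0 (- r)"]) auto
qed

text \<open>First-order optimality as a variational inequality, to be summed over the variables of a
  market against a competing schedule.\<close>

lemma kkt_bounded_step:
  assumes "kkt_bounded r a x b" "a \<le> x'" "x' \<le> b"
  shows "0 \<le> r * (x' - x)"
  using assms unfolding kkt_bounded_iff
  by (smt (verit) mult_nonneg_nonneg mult_nonpos_nonpos mult_eq_0_iff)

text \<open>Balanced positions satisfy \<open>q = - p\<close>, so the profit is linear in a
  \<open>p\<close> of free sign and has a maximum only if the coefficient vanishes.\<close>

lemma arbitrager_optimal_iff:
  assumes "prob_space M" and "integrable M (price_bal e)"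
  shows "arbitrager_optimal M e \<longleftrightarrow>
    arbitrage_feasible M (virt e) (adj_virt e) \<and> price_fwd e = (\<integral>\<omega>. price_bal e \<omega> \<partial>M)"
proof -
  have profit: "arbitrage_profit M (price_fwd e) (price_bal e) p q
      = p * (price_fwd e - (\<integral>\<omega>. price_bal e \<omega> \<partial>M))"
    if "arbitrage_feasible M p q" for p q
  proof -
    have "(\<integral>\<omega>. q \<omega> * price_bal e \<omega> \<partial>M) = (\<integral>\<omega>. - p * price_bal e \<omega> \<partial>M)"
      using that by (intro Bochner_Integration.integral_cong refl)
        (simp add: arbitrage_feasible_def add_eq_0_iff)
    then show ?thesis
      by (simp add: arbitrage_profit_def right_diff_distrib)
  qed
  have feas: "arbitrage_feasible M p (\<lambda>_. - p)" for p
    by (simp add: arbitrage_feasible_def)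
  define g where "g = price_fwd e - (\<integral>\<omega>. price_bal e \<omega> \<partial>M)"
  have "(\<forall>p. p * g \<le> virt e * g) \<longleftrightarrow> g = 0"
  proof
    assume "\<forall>p. p * g \<le> virt e * g"
    \<comment> \<open>Enlarging the position by the gap \<open>g\<close> itself would add
      \<open>g * g\<close> to the profit.\<close>
    then have "(virt e + g) * g \<le> virt e * g" by blast
    then have "g * g \<le> 0" by (simp add: distrib_right)
    then show "g = 0" by (metis antisym mult_eq_0_iff zero_le_square)
  qed simp
  moreover have "arbitrager_optimal M e \<longleftrightarrow>
      arbitrage_feasible M (virt e) (adj_virt e) \<and> (\<forall>p. p * g \<le> virt e * g)"
    unfolding arbitrager_optimal_def using profit[folded g_def] feas by metis
  ultimately show ?thesis
    by (simp add: g_def)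
qed

text \<open>Continuity makes the superlevel set closed, so that infima such as \<open>l2\<close> and
  \<open>l6\<close> are attained.\<close>

lemma Inf_superlevel_mem:
  fixes G :: "real \<Rightarrow> real"
  assumes "continuous_on UNIV G" and "\<exists>t\<ge>a. k \<le> G t"
  shows "Inf {t. a \<le> t \<and> k \<le> G t} \<in> {t. a \<le> t \<and> k \<le> G t}"
proof -
  have "closed {t. a \<le> t \<and> k \<le> G t}"
    using assms(1) by (intro closed_Collect_conj closed_Collect_le continuous_on_const continuous_on_id)
  then show ?thesis
    using assms(2) by (intro closed_contains_Inf bdd_belowI[of _ a]) auto
qed

text \<open>The intermediate value theorem yields a point of value \<open>k\<close> at or before the
  infimum; it belongs to the set, hence equals the infimum.\<close>

lemma Inf_superlevel_value:
  fixes G :: "real \<Rightarrow> real"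
  assumes G: "continuous_on UNIV G" and "\<exists>t\<ge>a. k \<le> G t" and "G a \<le> k"
  shows "G (Inf {t. a \<le> t \<and> k \<le> G t}) = k"
proof -
  let ?i = "Inf {t. a \<le> t \<and> k \<le> G t}"
  have i: "a \<le> ?i" "k \<le> G ?i"
    using Inf_superlevel_mem[OF assms(1,2)] by auto
  then obtain s where s: "a \<le> s" "s \<le> ?i" "G s = k"
    using IVT'[of G a k ?i] assms(3) continuous_on_subset[OF G] by auto
  then have "?i \<le> s"
    by (intro cInf_lower bdd_belowI[of _ a]) auto
  then show ?thesis using s by simp
qed

section \<open>The market and the distribution of the stochastic output\<close>

text \<open>The density of \<open>W\<close> enters as \<open>atomless\<close>: it makes
  \<open>F\<close> continuous and the boundary outcomes of the balancing stage null.\<close>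

locale power_market = prob_space M for M :: "'a measure" +
  fixes S :: power_system and W :: "'a \<Rightarrow> real" and l :: real
  assumes valid: "valid_power_system S"
    and W_measurable [measurable]: "W \<in> borel_measurable M"
    and atomless: "\<And>t. AE \<omega> in M. W \<omega> \<noteq> t"
    and W_range: "\<And>\<omega>. \<omega> \<in> space M \<Longrightarrow> 0 \<le> W \<omega> \<and> W \<omega> \<le> cap_W S"
    and demand_nonneg: "0 \<le> l"
    and merit_order: "c_I S < c_F S"
begin

abbreviation F :: "real \<Rightarrow> real" where "F \<equiv> cdf (distr M borel W)"

lemma params:
  "0 < cap_I S" "0 < cap_F S" "0 < cap_W S" "0 \<le> hat_W S" "0 < c_I S" "0 < c_F S"
  "c_up S < voll S" "c_F S \<le> c_up S" "c_dn S \<le> c_F S" "0 \<le> c_dn S"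
  using valid by (auto simp: valid_power_system_def)

sublocale W: real_distribution "distr M borel W"
  by (rule real_distribution_distr) simp

lemma F_eq_prob: "F t = \<P>(\<omega> in M. W \<omega> \<le> t)"
  by (simp add: cdf_def2 measure_distr vimage_def Int_def conj_commute)

lemma F_mono: "s \<le> t \<Longrightarrow> F s \<le> F t"
  by (rule W.cdf_nondecreasing)

lemma F_bounds: "0 \<le> F t" "F t \<le> 1"
  by (simp_all add: W.cdf_nonneg W.cdf_bounded_prob)

text \<open>At \<open>t = 0\<close> this rests on the absence of an atom at zero.\<close>

lemma F_eq_0: "t \<le> 0 \<Longrightarrow> F t = 0"
  using atomless[of 0] W_range
  by (fastforce simp: F_eq_prob prob_eq_0 elim: AE_mp)

lemma F_pos_imp_pos: "0 < F t \<Longrightarrow> 0 < t"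
  using F_eq_0[of t] by (cases "t \<le> 0") auto

lemma F_eq_1: "cap_W S \<le> t \<Longrightarrow> F t = 1"
  using W_range by (force simp: F_eq_prob prob_Collect_eq_1)

lemma F_continuous: "continuous_on A F"
proof -
  have "isCont F t" for t
  proof -
    have "measure (distr M borel W) {t} = \<P>(\<omega> in M. W \<omega> = t)"
      by (simp add: measure_distr vimage_def Int_def conj_commute)
    also have "\<dots> = 0"
      using atomless[of t] by (simp add: prob_eq_0)
    finally show ?thesis by (simp add: W.isCont_cdf)
  qed
  then show ?thesis by (simp add: continuous_at_imp_continuous_on)
qed

lemma expectation_indicator: "expectation (\<lambda>\<omega>. indicat_real {..t} (W \<omega>)) = F t"
proof -
  have "expectation (\<lambda>\<omega>. indicat_real {..t} (W \<omega>)) = (\<integral>s. indicat_real {..t} s \<partial>distr M borel W)"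
    by (subst integral_distr) auto
  then show ?thesis by (simp add: cdf_def2)
qed

lemma integrable_indicator [simp]: "integrable M (\<lambda>\<omega>. indicat_real {..t} (W \<omega>))"
  by (rule integrable_const_bound[of _ 1]) (auto simp: indicator_def)

section \<open>Prices and duality at the balancing stage\<close>

text \<open>For \<open>x\<close> between 0 and \<open>cap_F\<close> this is a step function of
  \<open>w\<close> descending through \<open>voll\<close>, \<open>c_up\<close>, \<open>c_dn\<close>,
  0, written as a telescoping sum of indicators so that its mean is linear in values of
  \<open>F\<close>.\<close>

definition balancing_price :: "real \<Rightarrow> real \<Rightarrow> real \<Rightarrow> real" where
  "balancing_price x D w = (voll S - c_up S) * indicat_real {..D - cap_F S} w +
     (c_up S - c_dn S) * indicat_real {..D - x} w + c_dn S * indicat_real {..D} w"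

definition mean_price :: "real \<Rightarrow> real \<Rightarrow> real" where
  "mean_price x D = (voll S - c_up S) * F (D - cap_F S) +
     (c_up S - c_dn S) * F (D - x) + c_dn S * F D"

lemma balancing_price_integrable: "integrable M (\<lambda>\<omega>. balancing_price x D (W \<omega>))"
  by (simp add: balancing_price_def)

lemma expectation_balancing_price:
  "expectation (\<lambda>\<omega>. balancing_price x D (W \<omega>)) = mean_price x D"
  by (simp add: balancing_price_def mean_price_def expectation_indicator)

lemma balancing_price_simps:
  assumes "0 \<le> x" "x \<le> cap_F S"
  shows "w \<le> D - cap_F S \<Longrightarrow> balancing_price x D w = voll S"
    and "D - cap_F S < w \<Longrightarrow> w \<le> D - x \<Longrightarrow> balancing_price x D w = c_up S"
    and "D - x < w \<Longrightarrow> w \<le> D \<Longrightarrow> balancing_price x D w = c_dn S"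
    and "D < w \<Longrightarrow> balancing_price x D w = 0"
  using assms by (auto simp: balancing_price_def)

text \<open>Flexible output after regulation when costless stochastic output is used first and
  curtailment last.\<close>

definition flex_output :: "real \<Rightarrow> real \<Rightarrow> real" where
  "flex_output D w = max 0 (min (D - w) (cap_F S))"

definition recourse_cost :: "real \<Rightarrow> real \<Rightarrow> real \<Rightarrow> real" where
  "recourse_cost x D w = voll S * max 0 (D - w - cap_F S) +
     c_up S * max 0 (flex_output D w - x) - c_dn S * max 0 (x - flex_output D w)"

text \<open>The Lagrangian dual function of the balancing problem: minimizing over upward and
  downward regulation leaves the two \<open>max\<close> terms; for \<open>p\<close> between 0 and
  \<open>voll\<close>, stochastic output contributes \<open>- p * w\<close> and curtailment
  nothing.\<close>

definition dual_cost :: "real \<Rightarrow> real \<Rightarrow> real \<Rightarrow> real \<Rightarrow> real" where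
  "dual_cost p x D w = p * (D - x - w) - max 0 (p - c_up S) * (cap_F S - x) - max 0 (c_dn S - p) * x"

lemma weak_duality:
  assumes "0 \<le> p" "p \<le> voll S"
    and "a - b + g + s = D - x" "0 \<le> a" "a \<le> cap_F S - x" "0 \<le> b" "b \<le> x" "g \<le> w" "0 \<le> s"
  shows "dual_cost p x D w \<le> voll S * s + c_up S * a - c_dn S * b"
proof -
  have "p * (D - x - w) = p * (a - b + s) + p * (g - w)"
    using assms(3) by (simp flip: distrib_left)
  moreover have "p * (g - w) \<le> 0"
    using assms by (intro mult_nonneg_nonpos) auto
  moreover have "p * s \<le> voll S * s"
    using assms by (intro mult_right_mono) auto
  moreover have "(p - c_up S) * a \<le> max 0 (p - c_up S) * (cap_F S - x)"
    using assms by (intro mult_mono) auto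
  moreover have "(c_dn S - p) * b \<le> max 0 (c_dn S - p) * x"
    using assms by (intro mult_mono) auto
  ultimately show ?thesis
    by (simp add: dual_cost_def algebra_simps)
qed

lemma balancing_price_bounds:
  assumes "0 \<le> x" "x \<le> cap_F S"
  shows "0 \<le> balancing_price x D w" "balancing_price x D w \<le> voll S"
  using balancing_price_simps[OF assms, where w = w and D = D] params by linarith+

text \<open>Strong duality: in each of the four regimes of \<open>w\<close> the merit-order schedule
  and the price of that regime are complementary.\<close>

lemma recourse_cost_eq_dual:
  assumes "0 \<le> x" "x \<le> cap_F S"
  shows "recourse_cost x D w = dual_cost (balancing_price x D w) x D w"
proof -
  consider "w \<le> D - cap_F S" | "D - cap_F S < w" "w \<le> D - x" | "D - x < w" "w \<le> D" | "D < w"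
    by linarith
  then show ?thesis
    by cases (use assms params in \<open>simp_all add: balancing_price_simps recourse_cost_def flex_output_def dual_cost_def
      max_def min_def algebra_simps\<close>)
qed

lemma dual_le_recourse_cost:
  assumes "0 \<le> x" "x \<le> cap_F S" "0 \<le> p" "p \<le> voll S"
  shows "dual_cost p x D w \<le> recourse_cost x D w"
  unfolding recourse_cost_def
  \<comment> \<open>\<open>g\<close> is the stochastic output used by the merit-order schedule,
    equal to \<open>min w D\<close>.\<close>
  by (rule weak_duality[where g = "D - flex_output D w - max 0 (D - w - cap_F S)"])
    (use assms in \<open>auto simp: flex_output_def\<close>)

text \<open>The dual cost at a fixed price is affine in \<open>(x, D)\<close>, lies below the recourse cost everywhere and
  touches it where that price is a balancing price.\<close>

lemma recourse_subgradient:
  assumes "0 \<le> x" "x \<le> cap_F S" "0 \<le> x'" "x' \<le> cap_F S"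
  shows "recourse_cost x D w + balancing_price x D w * (D' - D) -
      (c_dn S + (c_up S - c_dn S) * indicat_real {..D - x} w) * (x' - x)
    \<le> recourse_cost x' D' w"
proof -
  let ?p = "balancing_price x D w"
  \<comment> \<open>The left side is the price clipped to the interval from \<open>c_dn\<close> to
    \<open>c_up\<close>; it is minus the derivative of the dual cost in \<open>x\<close>.\<close>
  have "?p - max 0 (?p - c_up S) + max 0 (c_dn S - ?p) = c_dn S + (c_up S - c_dn S) * indicat_real {..D - x} w"
  proof -
    consider "w \<le> D - cap_F S" | "D - cap_F S < w" "w \<le> D - x" | "D - x < w" "w \<le> D" | "D < w"
      by linarith
    then show ?thesis
      by cases (use assms params in \<open>simp_all add: balancing_price_simps\<close>)
  qed
  moreover have "dual_cost ?p x' D' w = dual_cost ?p x D w + ?p * (D' - D) -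
      (?p - max 0 (?p - c_up S) + max 0 (c_dn S - ?p)) * (x' - x)"
    unfolding dual_cost_def by (simp add: algebra_simps)
  ultimately show ?thesis
    using dual_le_recourse_cost[OF assms(3,4) balancing_price_bounds[OF assms(1,2), of D w], of D' w]
      recourse_cost_eq_dual[OF assms(1,2), of D w] by simp
qed

lemma recourse_cost_integrable: "integrable M (\<lambda>\<omega>. recourse_cost x D (W \<omega>))"
proof -
  have "integrable M W"
    using W_range by (intro integrable_const_bound[of _ "cap_W S"]) auto
  then show ?thesis
    unfolding recourse_cost_def flex_output_def by (auto intro!: integrable_max integrable_min)
qed

section \<open>Expected total cost as a function of the forward quantities\<close>

definition total_cost :: "real \<Rightarrow> real \<Rightarrow> real" where
  "total_cost x y = c_I S * y + c_F S * x + expectation (\<lambda>\<omega>. recourse_cost x (l - y) (W \<omega>))"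

text \<open>Cost \<open>c_F\<close> of scheduling one more flexible unit ahead, less its expected
  saving: \<open>c_up\<close> if the unit would be called up, \<open>c_dn\<close> otherwise.\<close>

definition slope :: "real \<Rightarrow> real \<Rightarrow> real" where
  "slope x D = c_F S - c_dn S - (c_up S - c_dn S) * F (D - x)"

text \<open>The pathwise inequality is integrated; raising \<open>y\<close> lowers \<open>D\<close>,
  hence the minus sign before \<open>mean_price\<close>.\<close>

lemma total_cost_subgradient:
  assumes "0 \<le> x" "x \<le> cap_F S" "0 \<le> x'" "x' \<le> cap_F S"
  shows "total_cost x y + slope x (l - y) * (x' - x) + (c_I S - mean_price x (l - y)) * (y' - y)
    \<le> total_cost x' y'"
proof -
  let ?D = "l - y" and ?D' = "l - y'"
  have "expectation (\<lambda>\<omega>. recourse_cost x ?D (W \<omega>) + balancing_price x ?D (W \<omega>) * (?D' - ?D) -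
      (c_dn S + (c_up S - c_dn S) * indicat_real {..?D - x} (W \<omega>)) * (x' - x))
    \<le> expectation (\<lambda>\<omega>. recourse_cost x' ?D' (W \<omega>))"
    by (intro integral_mono recourse_subgradient assms recourse_cost_integrable
      Bochner_Integration.integrable_diff Bochner_Integration.integrable_add
      integrable_mult_left balancing_price_integrable integrable_mult_right
      integrable_const integrable_indicator)
  then show ?thesis
    using recourse_cost_integrable balancing_price_integrable
    by (simp add: expectation_balancing_price expectation_indicator prob_space total_cost_def slope_def
      algebra_simps)
qed

definition in_box :: "real \<Rightarrow> real \<Rightarrow> bool" where
  "in_box x y \<longleftrightarrow> 0 \<le> x \<and> x \<le> cap_F S \<and> 0 \<le> y \<and> y \<le> cap_I S \<and> y \<le> l"

definition min_point :: "real \<Rightarrow> real \<Rightarrow> bool" where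
  "min_point x y \<longleftrightarrow> in_box x y \<and> (\<forall>x' y'. in_box x' y' \<longrightarrow> total_cost x y \<le> total_cost x' y')"

definition eq_point :: "real \<Rightarrow> real \<Rightarrow> bool" where
  "eq_point x y \<longleftrightarrow> in_box x y \<and>
     (x < cap_F S \<longrightarrow> mean_price x (l - y) \<le> c_F S) \<and> (0 < x \<longrightarrow> c_F S \<le> mean_price x (l - y)) \<and>
     (y < cap_I S \<longrightarrow> mean_price x (l - y) \<le> c_I S) \<and> (0 < y \<longrightarrow> c_I S \<le> mean_price x (l - y))"

lemma mean_price_bounds:
  assumes "0 \<le> x" "x \<le> cap_F S"
  shows "0 \<le> mean_price x D" "mean_price x D \<le> voll S"
proof -
  show "0 \<le> mean_price x D"
    using params F_bounds by (simp add: mean_price_def)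
  have "(voll S - c_up S) * F (D - cap_F S) \<le> voll S - c_up S"
    "(c_up S - c_dn S) * F (D - x) \<le> c_up S - c_dn S" "c_dn S * F D \<le> c_dn S"
    using params F_bounds by (simp_all add: mult_left_le)
  then show "mean_price x D \<le> voll S"
    by (simp add: mean_price_def)
qed

lemma mean_price_0: "0 \<le> x \<Longrightarrow> mean_price x 0 = 0"
  using params by (simp add: mean_price_def F_eq_0)

section \<open>Existence of cost minimizers and of equilibrium points\<close>

text \<open>Both subgradient components are bounded, so the subgradient inequality, used in both
  directions, makes the cost Lipschitz and hence continuous on the compact box.\<close>

lemma min_point_exists: "\<exists>x y. min_point x y"
proof -
  let ?B = "{0..cap_F S} \<times> {0..min (cap_I S) l}"
  let ?J = "\<lambda>z. total_cost (fst z) (snd z)"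
  \<comment> \<open>A common bound: \<open>slope\<close> is at most \<open>voll\<close> in absolute
    value, and \<open>c_I - mean_price\<close> lies between \<open>- voll\<close> and
    \<open>c_I\<close>.\<close>
  let ?K = "voll S + c_I S"
  have slope: "\<bar>slope x D\<bar> \<le> ?K" for x D
  proof -
    have "0 \<le> (c_up S - c_dn S) * F (D - x)" "(c_up S - c_dn S) * F (D - x) \<le> c_up S - c_dn S"
      using params F_bounds by (simp_all add: mult_left_le)
    then show ?thesis using params unfolding slope_def by linarith
  qed
  have one_sided: "?J z - ?J z' \<le> 2 * ?K * dist z z'" if "z \<in> ?B" "z' \<in> ?B" for z z'
  proof -
    obtain x y x' y' where z: "z = (x, y)" "z' = (x', y')" by (cases z, cases z')
    have "\<bar>slope x (l - y) * (x' - x)\<bar> \<le> ?K * dist z z'"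
      unfolding abs_mult z using slope dist_fst_le[of "(x, y)" "(x', y')"] params
      by (intro mult_mono) (auto simp: dist_real_def)
    moreover have "\<bar>(c_I S - mean_price x (l - y)) * (y' - y)\<bar> \<le> ?K * dist z z'"
      unfolding abs_mult z
      using mean_price_bounds[of x "l - y"] dist_snd_le[of "(x, y)" "(x', y')"] params that z
      by (intro mult_mono) (auto simp: dist_real_def)
    ultimately show ?thesis
      using total_cost_subgradient[of x x' y y'] that z by (auto simp: abs_le_iff algebra_simps)
  qed
  have "(2 * ?K)-lipschitz_on ?B ?J"
  proof (rule lipschitz_onI)
    show "dist (?J z) (?J z') \<le> 2 * ?K * dist z z'" if "z \<in> ?B" "z' \<in> ?B" for z z'
      using one_sided[OF that] one_sided[OF that(2,1)] by (simp add: dist_real_def dist_commute)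
  qed (use params in simp)
  then have "continuous_on ?B ?J"
    by (rule lipschitz_on_continuous_on)
  moreover have "compact ?B" "?B \<noteq> {}"
    using params demand_nonneg by (auto intro: compact_Times)
  ultimately obtain z where "z \<in> ?B" "\<forall>z'\<in>?B. ?J z \<le> ?J z'"
    using continuous_attains_inf[of ?B ?J] by blast
  then show ?thesis
    unfolding min_point_def in_box_def
    by (intro exI[of _ "fst z"] exI[of _ "snd z"]) (auto simp: mem_Times_iff)
qed

text \<open>Along the merit-order path, first raising \<open>y\<close> to capacity at \<open>x = 0\<close> and then raising \<open>x\<close>, the
  mean price decreases continuously; an equilibrium is where it meets the marginal cost.\<close>

lemma eq_point_exists: "\<exists>x y. eq_point x y"
proof -
  have cont: "continuous_on A (\<lambda>t. mean_price (x t) (D t))"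
    if "continuous_on A x" "continuous_on A D" for A :: "real set" and x D
  proof -
    have F: "continuous_on A (\<lambda>t. F (g t))" if "continuous_on A g" for g
      by (rule continuous_on_compose2[OF F_continuous[of UNIV] that]) simp
    show ?thesis
      unfolding mean_price_def
      by (intro continuous_on_add continuous_on_mult continuous_on_diff continuous_on_const F that)
  qed
  define m where "m = min (cap_I S) l"
  have m: "0 \<le> m" "m \<le> cap_I S" "m \<le> l"
    using params demand_nonneg by (auto simp: m_def)
  consider "mean_price 0 l \<le> c_I S"
    | "c_I S < mean_price 0 l" "mean_price 0 (l - m) \<le> c_I S"
    | "c_I S < mean_price 0 (l - m)" by linarith
  then show ?thesis
  proof cases
    case 1
    then have "eq_point 0 0"
      using params demand_nonneg merit_order by (auto simp: eq_point_def in_box_def)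
    then show ?thesis by blast
  next
    case 2
    have "\<exists>y\<ge>0. y \<le> m \<and> mean_price 0 (l - y) = c_I S"
      using IVT2'[of "\<lambda>y. mean_price 0 (l - y)" m "c_I S" 0] 2 m
        cont[of "{0..m}" "\<lambda>_. 0" "\<lambda>y. l - y"]
      by (simp add: continuous_on_diff)
    then obtain y where "0 \<le> y" "y \<le> m" "mean_price 0 (l - y) = c_I S" by blast
    then have "eq_point 0 y"
      using params m merit_order by (auto simp: eq_point_def in_box_def)
    then show ?thesis by blast
  next
    case 3
    \<comment> \<open>\<open>m = l\<close> would leave no residual demand and a zero price, so the
      inflexible capacity is what binds.\<close>
    then have "m \<noteq> l"
      using mean_price_0[of 0] params by auto
    then have m_eq: "m = cap_I S" "cap_I S \<le> l"
      by (auto simp: m_def)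
    define D where "D = l - cap_I S"
    consider "mean_price 0 D \<le> c_F S" | "c_F S \<le> mean_price (cap_F S) D"
      | "c_F S < mean_price 0 D" "mean_price (cap_F S) D < c_F S" by linarith
    then show ?thesis
    proof cases
      case 1
      then have "eq_point 0 (cap_I S)"
        using params 3 m_eq by (auto simp: eq_point_def in_box_def D_def)
      then show ?thesis by blast
    next
      case 2
      then have "eq_point (cap_F S) (cap_I S)"
        using params merit_order m_eq by (auto simp: eq_point_def in_box_def D_def)
      then show ?thesis by blast
    next
      case 3
      have "\<exists>x\<ge>0. x \<le> cap_F S \<and> mean_price x D = c_F S"
        using IVT2'[of "\<lambda>x. mean_price x D" "cap_F S" "c_F S" 0] 3 params
          cont[of "{0..cap_F S}" "\<lambda>x. x" "\<lambda>_. D"]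
        by simp
      then obtain x where "0 \<le> x" "x \<le> cap_F S" "mean_price x D = c_F S" by blast
      then have "eq_point x (cap_I S)"
        using params merit_order m_eq by (auto simp: eq_point_def in_box_def D_def)
      then show ?thesis by blast
    qed
  qed
qed

section \<open>Dispatches of both markets and points of the box\<close>

text \<open>The constraints common to both markets once the forward balance, respectively the
  virtual position, is eliminated; the record scheme lets them apply to dispatches and equilibria
  alike.\<close>

definition physical :: "('a, 'b) dispatch_scheme \<Rightarrow> bool" where
  "physical d \<longleftrightarrow> measurable_recourse M d \<and>
     0 \<le> fwd_F d \<and> fwd_F d \<le> cap_F S \<and> 0 \<le> fwd_I d \<and> fwd_I d \<le> cap_I S \<and>
     (\<forall>\<omega>\<in>space M.
        up d \<omega> - down d \<omega> + (fwd_W d + adj_W d \<omega>) + shed d \<omega> = l - fwd_I d - fwd_F d \<and>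
        0 \<le> down d \<omega> \<and> down d \<omega> \<le> fwd_F d \<and>
        0 \<le> up d \<omega> \<and> up d \<omega> \<le> cap_F S - fwd_F d \<and>
        0 \<le> fwd_W d + adj_W d \<omega> \<and> fwd_W d + adj_W d \<omega> \<le> W \<omega> \<and>
        0 \<le> shed d \<omega> \<and> shed d \<omega> \<le> l)"

lemma sm_feasible_iff:
  "sm_feasible S M W l d \<longleftrightarrow> physical d \<and> fwd_F d + fwd_I d + fwd_W d = l"
  unfolding sm_feasible_def physical_def by (auto simp: algebra_simps)

text \<open>Downward regulation is at most \<open>fwd_F\<close>, so the balance at a single outcome
  already gives \<open>fwd_I \<le> l\<close>.\<close>

lemma physical_in_box:
  assumes "physical d"
  shows "in_box (fwd_F d) (fwd_I d)"
proof -
  obtain \<omega> where "\<omega> \<in> space M" using not_empty by blast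
  then have "fwd_I d \<le> l"
    using assms by (force simp: physical_def)
  then show ?thesis
    using assms by (simp add: physical_def in_box_def)
qed

lemma physical_integrable:
  assumes "physical d"
  shows "integrable M (\<lambda>\<omega>. voll S * shed d \<omega> + c_up S * up d \<omega> - c_dn S * down d \<omega>)"
proof -
  have bounded: "integrable M g"
    if "g \<in> borel_measurable M" "\<And>\<omega>. \<omega> \<in> space M \<Longrightarrow> \<bar>g \<omega>\<bar> \<le> b" for g :: "'a \<Rightarrow> real" and b
    using that by (intro integrable_const_bound[of _ b]) auto
  have "integrable M (shed d)" "integrable M (up d)" "integrable M (down d)"
    using assms unfolding physical_def measurable_recourse_def
    by (auto intro: bounded[of _ l] bounded[of _ "cap_F S - fwd_F d"] bounded[of _ "fwd_F d"])
  then show ?thesis by simp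
qed

text \<open>Weak duality at each outcome, taken at its balancing price.\<close>

lemma total_cost_le_operating_cost:
  assumes "physical d"
  shows "total_cost (fwd_F d) (fwd_I d) \<le> operating_cost S M d"
proof -
  have "expectation (\<lambda>\<omega>. recourse_cost (fwd_F d) (l - fwd_I d) (W \<omega>)) \<le>
    expectation (\<lambda>\<omega>. voll S * shed d \<omega> + c_up S * up d \<omega> - c_dn S * down d \<omega>)"
  proof (intro integral_mono recourse_cost_integrable physical_integrable assms)
    fix \<omega> assume "\<omega> \<in> space M"
    then show "recourse_cost (fwd_F d) (l - fwd_I d) (W \<omega>)
        \<le> voll S * shed d \<omega> + c_up S * up d \<omega> - c_dn S * down d \<omega>"
      using assms
      by (subst recourse_cost_eq_dual)
        (auto simp: physical_def intro!: weak_duality[where g = "fwd_W d + adj_W d \<omega>"] balancing_price_bounds)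
  qed
  then show ?thesis
    by (simp add: total_cost_def operating_cost_def)
qed

text \<open>Merit-order recourse at \<open>(x, y)\<close> together with the dual prices.
  \<open>pW\<close> is left open: \<open>l - x - y\<close> balances the stochastic market,
  \<open>hat_W\<close> suits the conventional forward market.\<close>

definition std_eq :: "real \<Rightarrow> real \<Rightarrow> real \<Rightarrow> 'a equilibrium" where
  "std_eq pW x y =
    \<lparr>fwd_I = y, fwd_F = x, fwd_W = pW,
     up = \<lambda>\<omega>. max 0 (flex_output (l - y) (W \<omega>) - x),
     down = \<lambda>\<omega>. max 0 (x - flex_output (l - y) (W \<omega>)),
     adj_W = \<lambda>\<omega>. min (W \<omega>) (l - y) - pW,
     shed = \<lambda>\<omega>. max 0 (l - y - W \<omega> - cap_F S),
     virt = l - x - y - pW, adj_virt = \<lambda>\<omega>. - (l - x - y - pW),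
     price_fwd = mean_price x (l - y), price_bal = \<lambda>\<omega>. balancing_price x (l - y) (W \<omega>)\<rparr>"

lemma std_eq_simps [simp]:
  "fwd_I (std_eq pW x y) = y" "fwd_F (std_eq pW x y) = x" "fwd_W (std_eq pW x y) = pW"
  by (simp_all add: std_eq_def)

lemma operating_cost_std_eq: "operating_cost S M (std_eq pW x y) = total_cost x y"
  by (simp add: operating_cost_def total_cost_def recourse_cost_def std_eq_def)

lemma physical_std_eq:
  assumes "in_box x y"
  shows "physical (std_eq pW x y)"
proof -
  have "measurable_recourse M (std_eq pW x y)"
    unfolding measurable_recourse_def std_eq_def flex_output_def by simp
  moreover have "0 \<le> x" "x \<le> cap_F S" "0 \<le> y" "y \<le> cap_I S" "y \<le> l"
    using assms by (simp_all add: in_box_def)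
  moreover have "0 \<le> W \<omega>" if "\<omega> \<in> space M" for \<omega>
    using W_range that by blast
  ultimately show ?thesis
    using params
    by (force simp: physical_def std_eq_def flex_output_def)
qed

lemma truncate_simps:
  "physical (dispatch.truncate e) \<longleftrightarrow> physical e"
  "operating_cost S M (dispatch.truncate e) = operating_cost S M e"
  by (simp_all add: physical_def operating_cost_def measurable_recourse_def dispatch.truncate_def)

lemma std_sm_feasible:
  assumes "in_box x y"
  shows "sm_feasible S M W l (dispatch.truncate (std_eq (l - x - y) x y))"
  using physical_std_eq[OF assms, of "l - x - y"]
  by (simp add: sm_feasible_iff truncate_simps) (simp add: dispatch.truncate_def)

text \<open>Each point of the box is realized at its \<open>total_cost\<close>, and no feasible
  dispatch undercuts the \<open>total_cost\<close> of its own point; the stochastic market is thus a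
  minimization over the box.\<close>

lemma stochastic_solution_cost:
  assumes "stochastic_solution S M W l d"
  shows "operating_cost S M d = total_cost (fwd_F d) (fwd_I d)" "min_point (fwd_F d) (fwd_I d)"
proof -
  have d: "physical d"
    using assms by (simp add: stochastic_solution_def sm_feasible_iff)
  have le: "operating_cost S M d \<le> total_cost x y" if "in_box x y" for x y
    using assms std_sm_feasible[OF that]
    by (metis operating_cost_std_eq stochastic_solution_def truncate_simps(2))
  then show "operating_cost S M d = total_cost (fwd_F d) (fwd_I d)"
    using total_cost_le_operating_cost[OF d] physical_in_box[OF d] by (intro antisym) auto
  with le show "min_point (fwd_F d) (fwd_I d)"
    using physical_in_box[OF d] by (simp add: min_point_def)
qed

lemma stochastic_solution_exists: "\<exists>d. stochastic_solution S M W l d"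
proof -
  obtain x y where xy: "min_point x y" using min_point_exists by blast
  let ?d = "dispatch.truncate (std_eq (l - x - y) x y)"
  have "operating_cost S M ?d \<le> operating_cost S M d'" if "sm_feasible S M W l d'" for d'
  proof -
    have d': "physical d'" using that by (simp add: sm_feasible_iff)
    have "operating_cost S M ?d = total_cost x y"
      by (simp add: truncate_simps operating_cost_std_eq)
    also have "\<dots> \<le> total_cost (fwd_F d') (fwd_I d')"
      using xy physical_in_box[OF d'] by (simp add: min_point_def)
    also have "\<dots> \<le> operating_cost S M d'"
      by (rule total_cost_le_operating_cost[OF d'])
    finally show ?thesis .
  qed
  then show ?thesis
    using xy std_sm_feasible unfolding stochastic_solution_def min_point_def by blast
qed

lemma price_consistent_std_eq:
  assumes "eq_point x y"
  shows "price_consistent_solution S M W l (std_eq (hat_W S) x y)"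
proof -
  let ?e = "std_eq (hat_W S) x y" and ?D = "l - y"
  have box: "0 \<le> x" "x \<le> cap_F S" "0 \<le> y" "y \<le> cap_I S" "y \<le> l"
    using assms by (simp_all add: eq_point_def in_box_def)
  have price: "integrable M (price_bal ?e)" "price_fwd ?e = (\<integral>\<omega>. price_bal ?e \<omega> \<partial>M)"
    by (simp_all add: std_eq_def balancing_price_integrable expectation_balancing_price)
  \<comment> \<open>The mean price is nonnegative, so accepting the full \<open>hat_W\<close> is
    optimal; the virtual bid absorbs the rest of the forward balance.\<close>
  have "forward_kkt S l ?e"
    using assms box params mean_price_bounds(1)[of x ?D]
    by (auto simp: forward_kkt_def kkt_bounded_iff std_eq_def eq_point_def)
  moreover have "balancing_kkt S W l ?e \<omega>" if "\<omega> \<in> space M" for \<omega>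
  proof -
    let ?w = "W \<omega>"
    have w: "0 \<le> ?w" using W_range that by blast
    consider "?w \<le> ?D - cap_F S" | "?D - cap_F S < ?w" "?w \<le> ?D - x"
      | "?D - x < ?w" "?w \<le> ?D" | "?D < ?w"
      by linarith
    then show ?thesis
      by cases (use box params w in \<open>auto simp: balancing_kkt_def kkt_bounded_iff std_eq_def
        flex_output_def balancing_price_simps max_def min_def\<close>)
  qed
  moreover have "arbitrager_optimal M ?e"
    unfolding arbitrager_optimal_iff[OF prob_space_axioms price(1)] using price(2)
    by (simp add: arbitrage_feasible_def std_eq_def)
  moreover have "measurable_recourse M ?e"
    using physical_std_eq assms by (simp add: physical_def eq_point_def)
  ultimately show ?thesis
    using price(1) by (simp add: price_consistent_solution_def)
qed

section \<open>Necessary conditions at an arbitrary equilibrium\<close>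

context
  fixes e :: "'a equilibrium"
  assumes e: "price_consistent_solution S M W l e"
begin

lemma arbitrage_free:
  "price_fwd e = (\<integral>\<omega>. price_bal e \<omega> \<partial>M)"
  "\<omega> \<in> space M \<Longrightarrow> adj_virt e \<omega> = - virt e"
proof -
  have "arbitrage_feasible M (virt e) (adj_virt e) \<and> price_fwd e = (\<integral>\<omega>. price_bal e \<omega> \<partial>M)"
    using e arbitrager_optimal_iff[OF prob_space_axioms, of e]
    unfolding price_consistent_solution_def by blast
  then show "price_fwd e = (\<integral>\<omega>. price_bal e \<omega> \<partial>M)"
    "\<omega> \<in> space M \<Longrightarrow> adj_virt e \<omega> = - virt e"
    by (simp_all add: arbitrage_feasible_def eq_neg_iff_add_eq_0 add.commute)
qed

lemma price_consistent_physical: "physical e"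
proof -
  have virt: "virt e = l - fwd_F e - fwd_I e - fwd_W e" and
    fwd: "0 \<le> fwd_F e" "fwd_F e \<le> cap_F S" "0 \<le> fwd_I e" "fwd_I e \<le> cap_I S"
    using e by (auto simp: price_consistent_solution_def forward_kkt_def kkt_bounded_iff)
  have rec: "up e \<omega> - down e \<omega> + adj_W e \<omega> + adj_virt e \<omega> + shed e \<omega> = 0 \<and>
      0 \<le> down e \<omega> \<and> down e \<omega> \<le> fwd_F e \<and>
      0 \<le> up e \<omega> \<and> up e \<omega> \<le> cap_F S - fwd_F e \<and>
      0 \<le> fwd_W e + adj_W e \<omega> \<and> fwd_W e + adj_W e \<omega> \<le> W \<omega> \<and>
      0 \<le> shed e \<omega> \<and> shed e \<omega> \<le> l" if "\<omega> \<in> space M" for \<omega>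
  proof -
    have "balancing_kkt S W l e \<omega>"
      using e that by (simp add: price_consistent_solution_def)
    then show ?thesis
      unfolding balancing_kkt_def kkt_bounded_iff by blast
  qed
  have "up e \<omega> - down e \<omega> + (fwd_W e + adj_W e \<omega>) + shed e \<omega> = l - fwd_I e - fwd_F e"
    if "\<omega> \<in> space M" for \<omega>
    using rec[OF that] arbitrage_free(2)[OF that] virt by linarith
  moreover have "measurable_recourse M e"
    using e by (simp add: price_consistent_solution_def)
  ultimately show ?thesis
    unfolding physical_def using fwd rec by blast
qed

text \<open>The balancing conditions make the recourse at each outcome at most as costly as the
  merit-order one with the same forward quantities; the other inequality is weak duality.\<close>

lemma price_consistent_operating_cost: "operating_cost S M e = total_cost (fwd_F e) (fwd_I e)"
proof (rule antisym)
  let ?x = "fwd_F e" and ?y = "fwd_I e"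
  let ?s = "std_eq (fwd_W e) ?x ?y"
  have s: "physical ?s"
    using physical_std_eq physical_in_box[OF price_consistent_physical] by blast
  have "expectation (\<lambda>\<omega>. voll S * shed e \<omega> + c_up S * up e \<omega> - c_dn S * down e \<omega>)
    \<le> expectation (\<lambda>\<omega>. voll S * shed ?s \<omega> + c_up S * up ?s \<omega> - c_dn S * down ?s \<omega>)"
  proof (intro integral_mono physical_integrable s price_consistent_physical)
    fix \<omega> assume \<omega>: "\<omega> \<in> space M"
    let ?p = "price_bal e \<omega>"
    have kkt: "balancing_kkt S W l e \<omega>"
      using e \<omega> by (simp add: price_consistent_solution_def)
    have bounds: "0 \<le> down ?s \<omega>" "down ?s \<omega> \<le> fwd_F e" "0 \<le> up ?s \<omega>" "up ?s \<omega> \<le> cap_F S - fwd_F e"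
      "0 \<le> fwd_W ?s + adj_W ?s \<omega>" "fwd_W ?s + adj_W ?s \<omega> \<le> W \<omega>" "0 \<le> shed ?s \<omega>" "shed ?s \<omega> \<le> l"
      using s \<omega> unfolding physical_def by auto
    have "0 \<le> (c_up S - ?p) * (up ?s \<omega> - up e \<omega>)"
      "0 \<le> (- c_dn S + ?p) * (down ?s \<omega> - down e \<omega>)"
      "0 \<le> (- ?p) * ((fwd_W ?s + adj_W ?s \<omega>) - (fwd_W e + adj_W e \<omega>))"
      "0 \<le> (voll S - ?p) * (shed ?s \<omega> - shed e \<omega>)"
      using kkt unfolding balancing_kkt_def
      by (blast intro: kkt_bounded_step bounds)+
    \<comment> \<open>The four inequalities are summed; both schedules deliver the same net amount,
      so the price terms cancel.\<close>
    then have "0 \<le> (voll S * shed ?s \<omega> + c_up S * up ?s \<omega> - c_dn S * down ?s \<omega>)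
        - (voll S * shed e \<omega> + c_up S * up e \<omega> - c_dn S * down e \<omega>)
        - ?p * ((up ?s \<omega> - down ?s \<omega> + (fwd_W ?s + adj_W ?s \<omega>) + shed ?s \<omega>)
          - (up e \<omega> - down e \<omega> + (fwd_W e + adj_W e \<omega>) + shed e \<omega>))"
      by (simp add: algebra_simps)
    moreover have "up ?s \<omega> - down ?s \<omega> + (fwd_W ?s + adj_W ?s \<omega>) + shed ?s \<omega> = l - ?y - ?x"
      "up e \<omega> - down e \<omega> + (fwd_W e + adj_W e \<omega>) + shed e \<omega> = l - ?y - ?x"
      using s price_consistent_physical \<omega> unfolding physical_def by auto
    ultimately show "voll S * shed e \<omega> + c_up S * up e \<omega> - c_dn S * down e \<omega>
        \<le> voll S * shed ?s \<omega> + c_up S * up ?s \<omega> - c_dn S * down ?s \<omega>"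
      by simp
  qed
  then show "operating_cost S M e \<le> total_cost ?x ?y"
    unfolding operating_cost_std_eq[of "fwd_W e", symmetric]
    by (simp add: operating_cost_def)
qed (rule total_cost_le_operating_cost[OF price_consistent_physical])

text \<open>Strictly inside each regime some source can supply more and some source can supply less,
  and their costs pin the price from both sides.\<close>

lemma price_bal_unique:
  assumes \<omega>: "\<omega> \<in> space M" and D: "D = l - fwd_I e" "0 < D"
    and generic: "W \<omega> \<notin> {0, D - cap_F S, D - fwd_F e, D}"
  shows "price_bal e \<omega> = balancing_price (fwd_F e) D (W \<omega>)"
proof -
  let ?x = "fwd_F e" and ?p = "price_bal e \<omega>" and ?w = "W \<omega>"
  define a b g s where abgs: "a = up e \<omega>" "b = down e \<omega>" "g = fwd_W e + adj_W e \<omega>" "s = shed e \<omega>"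
  have phys: "a - b + g + s = D - ?x" "0 \<le> b" "b \<le> ?x" "0 \<le> a" "a \<le> cap_F S - ?x"
    "0 \<le> g" "g \<le> ?w" "0 \<le> s" "s \<le> l" "?x \<le> cap_F S" "0 \<le> ?x" "D \<le> l"
    using price_consistent_physical \<omega> D by (auto simp: physical_def abgs)
  have kkt: "a < cap_F S - ?x \<Longrightarrow> ?p \<le> c_up S" "0 < a \<Longrightarrow> c_up S \<le> ?p"
    "b < ?x \<Longrightarrow> c_dn S \<le> ?p" "0 < b \<Longrightarrow> ?p \<le> c_dn S"
    "g < ?w \<Longrightarrow> ?p \<le> 0" "0 < g \<Longrightarrow> 0 \<le> ?p"
    "s < l \<Longrightarrow> ?p \<le> voll S" "0 < s \<Longrightarrow> voll S \<le> ?p"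
    using e \<omega> by (auto simp: price_consistent_solution_def balancing_kkt_def kkt_bounded_iff abgs)
  consider "?w < D - cap_F S" | "D - cap_F S < ?w" "?w < D - ?x" | "D - ?x < ?w" "?w < D" | "D < ?w"
    using generic by fastforce
  then show ?thesis
  proof cases
    case 1
    then have "0 < s" using phys by linarith
    \<comment> \<open>Full curtailment \<open>s = l\<close> gives no upper bound by itself, but it
      forces \<open>a = 0\<close> and \<open>b = ?x\<close>, and then the flexible unit caps the
      price below \<open>voll\<close>.\<close>
    moreover have "s < l \<or> ?p \<le> voll S"
    proof (rule ccontr)
      assume "\<not> ?thesis"
      then have "s = l" "voll S < ?p" using phys by auto
      then have "a = 0" "b = ?x" using phys by linarith+
      then show False using kkt(1,4) \<open>voll S < ?p\<close> params by fastforce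
    qed
    ultimately have "?p = voll S"
      using kkt(7,8) by force
    then show ?thesis using 1 phys by (simp add: balancing_price_simps)
  next
    case 2
    then have "0 < a \<or> 0 < s" using phys by linarith
    moreover have "a < cap_F S - ?x \<or> 0 < b \<or> g < ?w"
      using phys 2 kkt params by linarith
    ultimately have "?p = c_up S"
      using kkt params by linarith
    then show ?thesis using 2 phys by (simp add: balancing_price_simps)
  next
    case 3
    then have "0 < b \<or> g < ?w" using phys by linarith
    moreover have "b < ?x \<or> 0 < a \<or> 0 < s"
      using phys 3 by linarith
    ultimately have "?p = c_dn S"
      using kkt params by linarith
    then show ?thesis using 3 phys by (simp add: balancing_price_simps)
  next
    case 4
    then have "g < ?w" using phys by linarith
    moreover have "0 < g \<or> b < ?x \<or> 0 < a \<or> 0 < s"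
      using phys 4 D by linarith
    ultimately have "?p = 0"
      using kkt params by linarith
    then show ?thesis using 4 phys by (simp add: balancing_price_simps)
  qed
qed

lemma price_consistent_eq_point: "eq_point (fwd_F e) (fwd_I e)"
proof -
  let ?x = "fwd_F e" and ?y = "fwd_I e"
  define D where "D = l - ?y"
  have box: "in_box ?x ?y"
    by (rule physical_in_box[OF price_consistent_physical])
  have fwd: "?x < cap_F S \<Longrightarrow> price_fwd e \<le> c_F S" "0 < ?x \<Longrightarrow> c_F S \<le> price_fwd e"
    "?y < cap_I S \<Longrightarrow> price_fwd e \<le> c_I S" "0 < ?y \<Longrightarrow> c_I S \<le> price_fwd e"
    using e by (auto simp: price_consistent_solution_def forward_kkt_def kkt_bounded_iff)
  show ?thesis
  proof (cases "0 < D")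
    case True
    have "AE \<omega> in M. price_bal e \<omega> = balancing_price ?x D (W \<omega>)"
      using atomless[of 0] atomless[of "D - cap_F S"] atomless[of "D - ?x"] atomless[of D] AE_space
    proof eventually_elim
      case (elim \<omega>)
      then show ?case using price_bal_unique[of \<omega> D] True D_def by simp
    qed
    then have "(\<integral>\<omega>. price_bal e \<omega> \<partial>M) = (\<integral>\<omega>. balancing_price ?x D (W \<omega>) \<partial>M)"
      using e balancing_price_integrable
      by (intro integral_cong_AE) (auto simp: price_consistent_solution_def)
    then have "price_fwd e = mean_price ?x D"
      using arbitrage_free(1) expectation_balancing_price by simp
    then show ?thesis
      using box fwd by (simp add: eq_point_def D_def)
  next
    case False
    then have D0: "?y = l" using box by (simp add: D_def in_box_def)
    have "AE \<omega> in M. price_bal e \<omega> \<le> 0"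
      using atomless[of 0] AE_space
    proof eventually_elim
      case (elim \<omega>)
      then have "0 < W \<omega>" using W_range by fastforce
      moreover have "fwd_W e + adj_W e \<omega> \<le> 0"
      proof -
        have "up e \<omega> - down e \<omega> + (fwd_W e + adj_W e \<omega>) + shed e \<omega> = - ?x"
          "down e \<omega> \<le> ?x" "0 \<le> up e \<omega>" "0 \<le> shed e \<omega>"
          using price_consistent_physical elim(2) D0 by (auto simp: physical_def)
        then show ?thesis by linarith
      qed
      ultimately show ?case
        using e elim(2) by (force simp: price_consistent_solution_def balancing_kkt_def kkt_bounded_iff)
    qed
    then have "price_fwd e \<le> 0"
      unfolding arbitrage_free(1)
      using integral_nonneg_AE[of "\<lambda>\<omega>. - price_bal e \<omega>" M] by simp
    then have xy: "?x = 0" "?y = 0"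
      using fwd(2,4) box params by (force simp: in_box_def)+
    have "mean_price ?x (l - ?y) = 0"
      using D0 xy mean_price_0[of 0] by simp
    then show ?thesis
      unfolding eq_point_def using box xy params by simp
  qed
qed

end

section \<open>Efficiency as a property of equilibrium points\<close>

lemma price_consistent_cost_iff:
  assumes "price_consistent_solution S M W l e" "stochastic_solution S M W l d"
  shows "operating_cost S M e = operating_cost S M d \<longleftrightarrow> min_point (fwd_F e) (fwd_I e)"
  using stochastic_solution_cost[OF assms(2)] price_consistent_operating_cost[OF assms(1)]
    physical_in_box[OF price_consistent_physical[OF assms(1)]]
  by (auto simp: min_point_def intro: antisym)

lemma solutions_exist: "solutions_exist S M W l"
  using eq_point_exists price_consistent_std_eq stochastic_solution_exists
  unfolding solutions_exist_def by blast

lemma always_efficientI: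
  assumes "\<And>x y. eq_point x y \<Longrightarrow> min_point x y"
  shows "always_efficient S M W l"
  using assms price_consistent_cost_iff price_consistent_eq_point solutions_exist
  unfolding always_efficient_def by blast

lemma possibly_efficientI:
  assumes "eq_point x y" "min_point x y"
  shows "possibly_efficient S M W l"
proof -
  obtain d where "stochastic_solution S M W l d" using stochastic_solution_exists by blast
  then show ?thesis
    using assms price_consistent_std_eq[OF assms(1)] price_consistent_cost_iff[of "std_eq (hat_W S) x y" d]
    unfolding possibly_efficient_def by auto
qed

lemma never_efficientI:
  assumes "\<And>x y. eq_point x y \<Longrightarrow> \<not> min_point x y"
  shows "never_efficient S M W l"
  using assms price_consistent_cost_iff price_consistent_eq_point solutions_exist
  unfolding never_efficient_def by blast

text \<open>The subgradient inequality turns sign conditions into global optimality; those in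
  \<open>y\<close> are already part of \<open>eq_point\<close>.\<close>

lemma min_pointI:
  assumes eq: "eq_point x y"
    and "0 < x \<Longrightarrow> slope x (l - y) \<le> 0" "x < cap_F S \<Longrightarrow> 0 \<le> slope x (l - y)"
  shows "min_point x y"
  unfolding min_point_def
proof (intro conjI allI impI)
  show "in_box x y" using eq by (simp add: eq_point_def)
  fix x' y' assume box': "in_box x' y'"
  have "0 \<le> slope x (l - y) * (x' - x)"
    using assms(2,3) box' by (cases x x' rule: linorder_cases)
      (auto simp: in_box_def intro: mult_nonneg_nonneg mult_nonpos_nonpos)
  moreover have "0 \<le> (c_I S - mean_price x (l - y)) * (y' - y)"
    using eq box' by (cases y y' rule: linorder_cases)
      (auto simp: eq_point_def in_box_def intro: mult_nonneg_nonneg mult_nonpos_nonpos)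
  ultimately show "total_cost x y \<le> total_cost x' y'"
    using total_cost_subgradient[of x x' y y'] eq box' by (auto simp: eq_point_def in_box_def)
qed

text \<open>Using the subgradient at the new point \<open>x'\<close> instead of a derivative at \<open>x\<close> avoids any
  differentiation of the expected cost.\<close>

lemma not_min_pointI:
  assumes "in_box x y" "x < x'" "x' \<le> cap_F S" "slope x' (l - y) < 0"
  shows "\<not> min_point x y"
proof -
  have "0 < slope x' (l - y) * (x - x')"
    using assms by (intro mult_neg_neg) auto
  then have "total_cost x' y < total_cost x y"
    using total_cost_subgradient[of x' x y y] assms by (simp add: in_box_def)
  moreover have "in_box x' y" using assms by (simp add: in_box_def)
  ultimately show ?thesis by (force simp: min_point_def)
qed

lemma mean_price_mono: "D \<le> D' \<Longrightarrow> mean_price x D \<le> mean_price x D'"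
  unfolding mean_price_def using params by (intro add_mono mult_left_mono F_mono) auto

lemma mean_price_antimono: "x \<le> x' \<Longrightarrow> mean_price x' D \<le> mean_price x D"
  unfolding mean_price_def using params by (intro add_mono mult_left_mono F_mono) auto

lemma eq_point_flexible:
  assumes "eq_point x y" "0 < x"
  shows "y = cap_I S" "c_F S \<le> mean_price x (l - cap_I S)"
proof -
  have "c_I S < mean_price x (l - y)"
    using assms merit_order by (auto simp: eq_point_def)
  then show "y = cap_I S"
    using assms by (auto simp: eq_point_def in_box_def)
  then show "c_F S \<le> mean_price x (l - cap_I S)"
    using assms by (auto simp: eq_point_def)
qed

text \<open>Serving all demand by inflexible output would bring the price to zero, below
  \<open>c_I\<close>.\<close>

lemma eq_point_residual_demand:
  assumes "eq_point x y" "0 < l"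
  shows "0 < l - y"
  using assms mean_price_0[of x] params by (cases "y = l") (auto simp: eq_point_def in_box_def)

lemma always_imp_possibly: "always_efficient S M W l \<Longrightarrow> possibly_efficient S M W l"
  unfolding always_efficient_def possibly_efficient_def solutions_exist_def by blast

section \<open>Generalized inverse, slope signs and demand thresholds\<close>

lemma F_gen_inverse:
  assumes "0 \<le> \<alpha>" "\<alpha> \<le> 1"
  shows "F (gen_inverse F \<alpha>) = \<alpha>"
proof (cases "\<alpha> = 0")
  case True
  let ?i = "Inf {t. 0 < F t}"
  have i: "?i \<le> t" if "0 < F t" for t
    using that by (intro cInf_lower bdd_belowI[of _ 0]) (auto simp: F_pos_imp_pos less_imp_le)
  \<comment> \<open>Otherwise continuity gives an earlier point where \<open>F\<close> is half as
    large and still positive.\<close>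
  have "\<not> 0 < F ?i"
  proof
    assume pos: "0 < F ?i"
    then obtain t where "F t = F ?i / 2" "t \<le> ?i"
      using IVT'[of F 0 "F ?i / 2" ?i] F_continuous F_eq_0[of 0] F_eq_0[of ?i] by fastforce
    moreover from this pos have "?i \<le> t" by (intro i) simp
    ultimately show False using pos by simp
  qed
  then show ?thesis
    using True F_bounds(1)[of ?i] by (simp add: gen_inverse_def)
next
  case False
  then have "0 \<le> t" if "\<alpha> \<le> F t" for t
    using that assms F_pos_imp_pos[of t] by simp
  then have "{t. \<alpha> \<le> F t} = {t. 0 \<le> t \<and> \<alpha> \<le> F t}" by blast
  moreover have "F (Inf {t. 0 \<le> t \<and> \<alpha> \<le> F t}) = \<alpha>"
  proof (rule Inf_superlevel_value[OF F_continuous])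
    show "\<exists>t\<ge>0. \<alpha> \<le> F t"
      using assms params F_eq_1[of "cap_W S"] by (intro exI[of _ "cap_W S"]) simp
    show "F 0 \<le> \<alpha>" using assms F_eq_0[of 0] by simp
  qed
  ultimately show ?thesis
    using False by (simp add: gen_inverse_def)
qed

lemma gen_inverse_le:
  assumes "0 < \<alpha>" "\<alpha> \<le> F t"
  shows "gen_inverse F \<alpha> \<le> t"
proof -
  have "0 \<le> s" if "\<alpha> \<le> F s" for s
    using that assms F_pos_imp_pos[of s] by simp
  then show ?thesis
    using assms by (auto simp: gen_inverse_def intro!: cInf_lower bdd_belowI[of _ 0])
qed

lemma gen_inverse_le_cap_W:
  assumes "0 \<le> \<alpha>" "\<alpha> \<le> 1"
  shows "gen_inverse F \<alpha> \<le> cap_W S"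
proof (cases "\<alpha> = 0")
  case True
  then show ?thesis
    using F_eq_1[of "cap_W S"]
    by (auto simp: gen_inverse_def less_imp_le F_pos_imp_pos intro!: cInf_lower bdd_belowI[of _ 0])
next
  case False
  then show ?thesis using assms F_eq_1[of "cap_W S"] by (auto intro: gen_inverse_le)
qed

lemma crit_ratio_bounds: "0 \<le> crit_ratio S" "crit_ratio S \<le> 1"
  using params by (auto simp: crit_ratio_def divide_le_eq_1)

text \<open>\<open>l1\<close> is the newsvendor quantile: \<open>F\<close> equals the critical ratio
  there, which is the value that makes the slope zero.\<close>

lemma slope_nonneg:
  assumes "c_dn S < c_up S" "D - x \<le> l1 S F"
  shows "0 \<le> slope x D"
proof -
  have "F (D - x) \<le> crit_ratio S"
    using F_mono[OF assms(2)] F_gen_inverse[OF crit_ratio_bounds] by (simp add: l1_def)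
  then show ?thesis
    using assms(1) by (simp add: slope_def crit_ratio_def pos_le_divide_eq mult.commute)
qed

lemma slope_nonneg_up_eq:
  assumes "c_up S = c_F S"
  shows "0 \<le> slope x D"
  using assms params F_bounds[of "D - x"] mult_left_le[of "F (D - x)" "c_F S - c_dn S"]
  by (simp add: slope_def)

lemma continuous_on_mean_price: "continuous_on A (\<lambda>t. mean_price x (t - a))"
proof -
  have F: "continuous_on A (\<lambda>t. F (t - b))" for b
    by (rule continuous_on_compose2[OF F_continuous[of UNIV]])
      (auto intro: continuous_on_diff continuous_on_id continuous_on_const)
  show ?thesis
    unfolding mean_price_def diff_diff_eq
    by (intro continuous_on_add continuous_on_mult continuous_on_const F)
qed

lemma mean_price_saturated:
  assumes "0 \<le> x" "x \<le> cap_F S" "cap_W S + cap_F S \<le> D"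
  shows "mean_price x D = voll S"
  using assms params F_eq_1[of "D - cap_F S"] F_eq_1[of "D - x"] F_eq_1[of D]
  by (simp add: mean_price_def)

text \<open>\<open>l2\<close>, \<open>l5\<close> and \<open>l6\<close> are thresholds of the mean
  price at \<open>x = 0\<close> or \<open>x = cap_F\<close>, where two of its three terms merge.
  Writing \<open>t - 0\<close> fits the shape of \<open>continuous_on_mean_price\<close>.\<close>

lemma l2_eq: "l2 S F = Inf {t. 0 \<le> t \<and> c_I S \<le> mean_price 0 (t - 0)}"
  by (simp add: l2_def mean_price_def algebra_simps)

lemma l5_eq: "l5 S F = Inf {t. 0 \<le> t \<and> c_F S \<le> mean_price 0 (t - cap_I S)}"
  by (simp add: l5_def mean_price_def algebra_simps)

lemma l6_eq: "l6 S F = Inf {t. 0 \<le> t \<and> c_F S \<le> mean_price (cap_F S) (t - cap_I S)}"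
  by (simp add: l6_def mean_price_def algebra_simps)

lemma mean_price_reaches:
  assumes "0 \<le> x" "x \<le> cap_F S" "k \<le> voll S" "0 \<le> a"
  shows "\<exists>t\<ge>0. k \<le> mean_price x (t - a)"
  using assms params mean_price_saturated[of x "cap_W S + cap_F S"]
  by (intro exI[of _ "cap_W S + cap_F S + a"]) auto

lemma mean_price_l2: "c_I S \<le> mean_price 0 (l2 S F)"
  using Inf_superlevel_mem[OF continuous_on_mean_price mean_price_reaches, of 0 "c_I S" 0]
    params merit_order by (simp add: l2_eq)

lemma mean_price_l5: "mean_price 0 (l5 S F - cap_I S) = c_F S"
proof -
  have "mean_price 0 (0 - cap_I S) \<le> c_F S"
    using mean_price_mono[of "- cap_I S" 0 0] mean_price_0[of 0] params by simp
  then show ?thesis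
    unfolding l5_eq using params
    by (intro Inf_superlevel_value continuous_on_mean_price mean_price_reaches) auto
qed

lemma mean_price_l6: "c_F S \<le> mean_price (cap_F S) (l6 S F - cap_I S)"
  using Inf_superlevel_mem[OF continuous_on_mean_price mean_price_reaches, of "cap_F S" "c_F S" "cap_I S"]
    params by (simp add: l6_eq)

lemma no_plateauD:
  assumes "no_plateau F" "s < t" "F t \<le> F s"
  shows "F t = 0 \<or> F t = 1"
proof (rule ccontr)
  assume "\<not> ?thesis"
  moreover have "F s = F t" using assms F_mono[of s t] by simp
  ultimately have "s \<in> {x. 0 < F x \<and> F x < 1}" "t \<in> {x. 0 < F x \<and> F x < 1}"
    using F_bounds[of t] by auto
  then have "F s < F t"
    using assms unfolding no_plateau_def by (blast dest: strict_mono_onD)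
  then show False using assms by simp
qed

section \<open>The five efficient cases\<close>

text \<open>Below \<open>l5\<close> the price at \<open>x = 0\<close> stays under
  \<open>c_F\<close>, and raising \<open>x\<close> cannot increase it; flexible scheduling is left
  only at \<open>l5\<close> itself, with equal prices at 0 and \<open>x\<close>.\<close>

lemma eq_point_flexible_below_l5:
  assumes "eq_point x y" "0 < x" "l \<le> l5 S F"
  shows "l = l5 S F" "mean_price x (l - cap_I S) = c_F S" "mean_price 0 (l - cap_I S) = c_F S"
proof -
  have x: "c_F S \<le> mean_price x (l - cap_I S)" "mean_price x (l - cap_I S) \<le> mean_price 0 (l - cap_I S)"
    using eq_point_flexible(2)[OF assms(1,2)] mean_price_antimono assms(2) by auto
  then have "l5 S F \<le> l"
    unfolding l5_eq using demand_nonneg by (intro cInf_lower bdd_belowI[of _ 0]) auto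
  then show "l = l5 S F" using assms by simp
  then show "mean_price 0 (l - cap_I S) = c_F S" using mean_price_l5 by simp
  then show "mean_price x (l - cap_I S) = c_F S" using x by simp
qed

text \<open>Equal prices make \<open>F\<close> flat from \<open>?D - x\<close> to \<open>?D\<close>.
  Without a plateau its value there is 0 or 1; 0 contradicts the positive price, and 1 forces
  \<open>c_up = c_F\<close>, where the slope vanishes.\<close>

lemma slope_eq_0_below_l5:
  assumes "eq_point x y" "0 < x" "l \<le> l5 S F" "no_plateau F"
  shows "slope x (l - y) = 0"
proof (cases "c_dn S < c_up S")
  case True
  let ?D = "l - cap_I S"
  note eq = eq_point_flexible_below_l5[OF assms(1-3)]
  have "(c_up S - c_dn S) * F ?D = (c_up S - c_dn S) * F (?D - x)"
    using eq(2,3) unfolding mean_price_def diff_0_right by linarith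
  then have FD: "F ?D = F (?D - x)" using True by simp
  then have "F ?D = 0 \<or> F ?D = 1"
    using no_plateauD[OF assms(4), of "?D - x" ?D] assms(2) by simp
  moreover have "F ?D \<noteq> 0"
    using eq(3) F_mono[of "?D - cap_F S" ?D] F_bounds(1)[of "?D - cap_F S"] params
    by (auto simp: mean_price_def)
  ultimately have F1: "F ?D = 1" by blast
  moreover have "c_up S \<le> c_F S"
  proof -
    have "0 \<le> (voll S - c_up S) * F (?D - cap_F S)"
      using params F_bounds by simp
    then show ?thesis
      using eq(3) F1 by (simp add: mean_price_def)
  qed
  ultimately show ?thesis
    using FD params eq_point_flexible(1)[OF assms(1,2)] by (simp add: slope_def)
next
  case False
  then have "c_up S = c_dn S" "c_F S = c_dn S" using params by auto
  then show ?thesis by (simp add: slope_def)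
qed

text \<open>An equilibrium point with \<open>0 < x\<close> can be exchanged for
  \<open>(0, cap_I)\<close>, which yields one efficient solution. Points with \<open>0 < x\<close>
  do not exist off \<open>l5\<close>, and without a plateau they have slope zero.\<close>

lemma efficient_below_l5:
  assumes "l \<le> l5 S F" and slope: "\<And>y. eq_point 0 y \<Longrightarrow> 0 \<le> slope 0 (l - y)"
  shows "possibly_efficient S M W l \<and> (l \<noteq> l5 S F \<or> no_plateau F \<longrightarrow> always_efficient S M W l)"
proof (intro conjI impI)
  have min0: "min_point 0 y" if "eq_point 0 y" for y
    using min_pointI[OF that] slope[OF that] by simp
  have nonneg: "0 \<le> x" if "eq_point x y" for x y
    using that by (simp add: eq_point_def in_box_def)
  obtain x y where xy: "eq_point x y" using eq_point_exists by blast
  have "\<exists>y. eq_point 0 y"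
  proof (cases "0 < x")
    case True
    have "in_box 0 (cap_I S)"
      using xy eq_point_flexible(1)[OF xy True] params by (simp add: eq_point_def in_box_def)
    then have "eq_point 0 (cap_I S)"
      using eq_point_flexible_below_l5(3)[OF xy True assms(1)] merit_order
      by (simp add: eq_point_def)
    then show ?thesis by blast
  next
    case False
    then show ?thesis using xy nonneg[OF xy] by (metis less_eq_real_def)
  qed
  then show "possibly_efficient S M W l"
    using min0 possibly_efficientI by blast
  assume gap: "l \<noteq> l5 S F \<or> no_plateau F"
  show "always_efficient S M W l"
  proof (rule always_efficientI)
    fix x y assume xy: "eq_point x y"
    show "min_point x y"
    proof (cases "0 < x")
      case True
      then have "slope x (l - y) = 0"
        using gap eq_point_flexible_below_l5(1)[OF xy True assms(1)] slope_eq_0_below_l5[OF xy True assms(1)]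
        by blast
      then show ?thesis using min_pointI[OF xy] by simp
    next
      case False
      then show ?thesis using xy nonneg[OF xy] min0 by (metis less_eq_real_def)
    qed
  qed
qed

lemma efficient_case1:
  assumes "case1 S F l"
  shows "possibly_efficient S M W l \<and> (l \<noteq> l5 S F \<or> no_plateau F \<longrightarrow> always_efficient S M W l)"
proof (rule efficient_below_l5)
  have c1: "c_dn S < c_up S" "l2 S F \<le> l1 S F" "l \<le> cap_I S + l1 S F" "l \<le> l5 S F"
    using assms by (auto simp: case1_def)
  show "l \<le> l5 S F" by fact
  fix y assume eq: "eq_point 0 y"
  let ?D = "l - y"
  show "0 \<le> slope 0 ?D"
  proof (cases "?D \<le> l1 S F")
    case True
    then show ?thesis using slope_nonneg[of ?D 0] c1 by simp
  next
    case False
    then have "y < cap_I S" using c1 eq by (auto simp: eq_point_def in_box_def)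
    then have "mean_price 0 ?D \<le> mean_price 0 (l1 S F)"
      using eq mean_price_l2 mean_price_mono[OF c1(2), of 0] by (auto simp: eq_point_def)
    moreover have "(voll S - c_up S) * F (l1 S F - cap_F S) \<le> (voll S - c_up S) * F (?D - cap_F S)"
      using False params by (intro mult_left_mono F_mono) auto
    ultimately have "c_up S * F ?D \<le> c_up S * F (l1 S F)"
      by (simp add: mean_price_def algebra_simps)
    then have "F ?D \<le> F (l1 S F)"
      using params by simp
    then have "slope 0 (l1 S F) \<le> slope 0 ?D"
      using c1(1) by (simp add: slope_def)
    then show ?thesis using slope_nonneg[OF c1(1), of "l1 S F" 0] by simp
  qed
qed

text \<open>The curtailment term vanishes and \<open>c_dn * F\<close> is at most
  \<open>c_dn\<close>, so the price condition for flexible production becomes the slope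
  condition.\<close>

lemma flexible_slope_nonpos:
  assumes "eq_point x y" "0 < x" "l - cap_I S \<le> cap_F S"
  shows "slope x (l - y) \<le> 0"
proof -
  have "c_dn S * F (l - cap_I S) \<le> c_dn S"
    using params F_bounds by (intro mult_left_le) auto
  then show ?thesis
    using eq_point_flexible[OF assms(1,2)] assms(3) F_eq_0[of "l - cap_I S - cap_F S"]
    by (simp add: mean_price_def slope_def)
qed

text \<open>\<open>l1 \<le> cap_W < cap_F\<close> rules out curtailment at full inflexible
  production. Otherwise the price is at most \<open>c_I\<close>, so \<open>F (l - y)\<close> is at
  most \<open>c_I / c_up\<close> and thus at most the critical ratio.\<close>

lemma efficient_case2:
  assumes "case2 S F l"
  shows "always_efficient S M W l"
proof (rule always_efficientI)
  have c2: "c_dn S < c_up S" "c_I S / c_up S \<le> crit_ratio S" "l \<le> cap_I S + l1 S F" "cap_W S < cap_F S"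
    using assms by (auto simp: case2_def)
  have l1: "l1 S F \<le> cap_W S"
    unfolding l1_def by (intro gen_inverse_le_cap_W crit_ratio_bounds)
  fix x y assume eq: "eq_point x y"
  then have x: "0 \<le> x" by (simp add: eq_point_def in_box_def)
  show "min_point x y"
  proof (rule min_pointI[OF eq])
    show "slope x (l - y) \<le> 0" if "0 < x"
      using flexible_slope_nonpos[OF eq that] c2 l1 by simp
    show "0 \<le> slope x (l - y)"
    proof (cases "y = cap_I S")
      case True
      then show ?thesis using x c2 by (intro slope_nonneg) auto
    next
      case False
      then have x0: "x = 0" using eq_point_flexible(1)[OF eq] x by fastforce
      have "mean_price 0 (l - y) \<le> c_I S"
        using eq False x0 by (auto simp: eq_point_def in_box_def)
      then have "(voll S - c_up S) * F (l - y - cap_F S) + c_up S * F (l - y) \<le> c_I S"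
        by (simp add: mean_price_def algebra_simps)
      moreover have "0 \<le> (voll S - c_up S) * F (l - y - cap_F S)"
        using params F_bounds by simp
      ultimately have "c_up S * F (l - y) \<le> c_I S" by simp
      then have "F (l - y) \<le> c_I S / c_up S"
        using params by (simp add: pos_le_divide_eq mult.commute)
      then have "F (l - y) \<le> crit_ratio S" using c2 by simp
      then show ?thesis
        using c2(1) x0 by (simp add: slope_def crit_ratio_def pos_le_divide_eq mult.commute)
    qed
  qed
qed

text \<open>After all forward production the demand left is at least \<open>cap_W\<close>, so
  \<open>F\<close> is 1 there and the slope is \<open>c_F - c_up = 0\<close>.\<close>

lemma efficient_high_demand:
  assumes "c_up S = c_F S" "cap_W S + cap_I S + cap_F S \<le> l"
  shows "always_efficient S M W l"
proof (rule always_efficientI)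
  fix x y assume eq: "eq_point x y"
  have "slope x (l - y) \<le> 0" if "0 < x"
  proof -
    have "x \<le> cap_F S" "y \<le> cap_I S"
      using eq by (simp_all add: eq_point_def in_box_def)
    then have "cap_W S \<le> l - y - x"
      using assms by linarith
    then show ?thesis using F_eq_1 assms by (simp add: slope_def)
  qed
  then show "min_point x y"
    by (rule min_pointI[OF eq]) (simp_all add: slope_nonneg_up_eq assms)
qed

lemma efficient_case3:
  assumes "case3 S F l"
  shows "possibly_efficient S M W l \<and> (l \<noteq> l5 S F \<or> no_plateau F \<longrightarrow> always_efficient S M W l)"
proof -
  consider "l \<le> l5 S F" | "cap_W S + cap_I S + cap_F S \<le> l"
    using assms by (force simp: case3_def)
  then show ?thesis
  proof cases
    case 1
    then show ?thesis
      using assms by (intro efficient_below_l5 slope_nonneg_up_eq) (auto simp: case3_def)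
  next
    case 2
    then have "always_efficient S M W l"
      using assms by (intro efficient_high_demand) (auto simp: case3_def)
    then show ?thesis using always_imp_possibly by blast
  qed
qed

lemma efficient_case4:
  assumes "case4 S l"
  shows "always_efficient S M W l"
proof (cases "cap_W S + cap_I S + cap_F S \<le> l")
  case True
  then show ?thesis using assms by (intro efficient_high_demand) (auto simp: case4_def)
next
  case False
  then have "c_up S = c_F S" "l - cap_I S \<le> cap_F S"
    using assms by (auto simp: case4_def)
  then show ?thesis
    by (intro always_efficientI min_pointI flexible_slope_nonpos slope_nonneg_up_eq)
qed

lemma efficient_case5:
  assumes "case5 S"
  shows "always_efficient S M W l"
  using assms by (intro always_efficientI min_pointI) (auto simp: case5_def slope_def)

section \<open>Downward regulation valued at the forward cost\<close>

context
  assumes costs: "c_F S = c_dn S" "c_F S < c_up S" and F0: "gen_inverse F 0 = 0"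
begin

lemma F_pos:
  assumes "0 < t"
  shows "0 < F t"
proof -
  have "cap_W S \<in> {s. 0 < F s}" using F_eq_1[of "cap_W S"] by simp
  then have "{s. 0 < F s} \<noteq> {}" by blast
  moreover have "Inf {s. 0 < F s} < t" using assms F0 by (simp add: gen_inverse_def)
  ultimately obtain s where "0 < F s" "s < t" using cInf_lessD[of "{s. 0 < F s}" t] by blast
  then show ?thesis using F_mono[of s t] by simp
qed

lemma F_le_0_iff: "F t \<le> 0 \<longleftrightarrow> t \<le> 0"
  using F_pos[of t] F_eq_0[of t] by linarith

lemma l1_eq_0: "l1 S F = 0"
  using costs F0 by (simp add: l1_def crit_ratio_def)

text \<open>The slope is \<open>- (c_up - c_F) * F (D - x)\<close>: never positive, and zero exactly
  for \<open>D \<le> x\<close>. More flexible scheduling therefore pays until that point or until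
  capacity.\<close>

lemma min_point_iff:
  assumes "eq_point x y"
  shows "min_point x y \<longleftrightarrow> x = cap_F S \<or> l - y \<le> x"
proof
  have slope: "slope x' D = - ((c_up S - c_F S) * F (D - x'))" for x' D
    using costs by (simp add: slope_def)
  have box: "in_box x y" using assms by (simp add: eq_point_def)
  have "slope x (l - y) \<le> 0"
    using costs mult_nonneg_nonneg[of "c_up S - c_F S" "F (l - y - x)"] F_bounds(1)[of "l - y - x"]
    unfolding slope by linarith
  moreover have "slope x (l - y) = 0" if "l - y \<le> x"
    unfolding slope using that F_eq_0[of "l - y - x"] by simp
  ultimately show "min_point x y" if "x = cap_F S \<or> l - y \<le> x"
    using that by (intro min_pointI[OF assms]) auto
  show "x = cap_F S \<or> l - y \<le> x" if "min_point x y"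
  proof (rule ccontr)
    assume "\<not> ?thesis"
    then have "x < cap_F S" "x < l - y" using box by (auto simp: in_box_def)
    \<comment> \<open>Any point strictly between \<open>x\<close> and \<open>l - y\<close> keeps
      \<open>F\<close> positive and the slope negative; this is the midpoint, cut off at
      capacity.\<close>
    moreover define x' where "x' = min (cap_F S) ((x + (l - y)) / 2)"
    ultimately have x': "x < x'" "x' \<le> cap_F S" "0 < l - y - x'" by (auto simp: min_def field_simps)
    have "0 < (c_up S - c_F S) * F (l - y - x')"
      using F_pos[OF x'(3)] costs by (intro mult_pos_pos) auto
    then have "\<not> min_point x y"
      using box x' by (intro not_min_pointI[of x y x']) (auto simp: slope)
    then show False using that by blast
  qed
qed

text \<open>With \<open>l1 = 0\<close>, \<open>l4\<close> is at least \<open>cap_F\<close>, and it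
  is at most any residual demand from \<open>cap_F\<close> on whose fully scheduled price reaches
  \<open>c_I\<close>. As \<open>c_I < c_F\<close>, reaching \<open>c_F\<close> suffices, which is
  the condition behind \<open>l6\<close>.\<close>

lemma exceptional_demand_iff:
  "exceptional_demand S F l \<longleftrightarrow>
    cap_F S \<le> l - cap_I S \<and> c_F S \<le> mean_price (cap_F S) (l - cap_I S)"
proof -
  have l4_set: "{t. l1 S F + cap_F S \<le> t \<and> (voll S - c_dn S) * F (t - cap_F S) + c_dn S * F t \<ge> c_I S}
    = {t. cap_F S \<le> t \<and> c_I S \<le> mean_price (cap_F S) t}"
    by (simp add: l1_eq_0 mean_price_def algebra_simps)
  have l4_ge: "ereal (cap_F S) \<le> l4 S F"
    unfolding l4_def l4_set by (intro Inf_greatest) auto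
  have l4_le: "l4 S F \<le> ereal t" if "cap_F S \<le> t" "c_I S \<le> mean_price (cap_F S) t" for t
    unfolding l4_def l4_set using that by (intro Inf_lower) auto
  show ?thesis
  proof
    assume ex: "exceptional_demand S F l"
    have "l6 S F \<le> l"
      using ex by (auto simp: exceptional_demand_def split: if_splits)
    then have "c_F S \<le> mean_price (cap_F S) (l - cap_I S)"
      using mean_price_l6 mean_price_mono[of "l6 S F - cap_I S" "l - cap_I S" "cap_F S"] by simp
    moreover have "ereal (cap_F S) + ereal (cap_I S) \<le> ereal l"
    proof (cases "ereal (cap_F S) < l3 S F")
      case True
      have "ereal (cap_F S) + ereal (cap_I S) \<le> l4 S F + ereal (cap_I S)"
        by (intro add_right_mono l4_ge)
      also have "\<dots> \<le> ereal l"
        using ex True by (simp add: exceptional_demand_def)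
      finally show ?thesis .
    next
      case False
      then show ?thesis using ex by (simp add: exceptional_demand_def)
    qed
    ultimately show "cap_F S \<le> l - cap_I S \<and> c_F S \<le> mean_price (cap_F S) (l - cap_I S)"
      by simp
  next
    assume R: "cap_F S \<le> l - cap_I S \<and> c_F S \<le> mean_price (cap_F S) (l - cap_I S)"
    then have "l6 S F \<le> l"
      unfolding l6_eq using demand_nonneg by (intro cInf_lower bdd_belowI[of _ 0]) auto
    moreover have "l4 S F + ereal (cap_I S) \<le> ereal (l - cap_I S) + ereal (cap_I S)"
      using R merit_order by (intro add_right_mono l4_le) auto
    ultimately show "exceptional_demand S F l"
      using R by (simp add: exceptional_demand_def)
  qed
qed

lemma degenerate_demand_iff:
  "degenerate_demand S F l \<longleftrightarrow> l = 0 \<or> F (l - cap_I S) = 1 \<and> l - cap_I S < cap_F S"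
proof -
  have "gen_inverse F 1 \<le> l - cap_I S \<longleftrightarrow> F (l - cap_I S) = 1"
    using F_gen_inverse[of 1] F_mono[of "gen_inverse F 1" "l - cap_I S"] F_bounds(2)[of "l - cap_I S"]
      gen_inverse_le[of 1 "l - cap_I S"] by auto
  then show ?thesis
    by (auto simp: degenerate_demand_def algebra_simps)
qed

text \<open>The fully scheduled point is an equilibrium and minimal. An equilibrium with
  \<open>x < cap_F\<close> would make \<open>F\<close> flat from \<open>?D - cap_F\<close> to
  \<open>?D - x\<close>: the value 0 is excluded by \<open>0 < ?D - x\<close>, and the value 1 would
  raise the price to \<open>voll\<close>.\<close>

lemma efficient_exceptional:
  assumes "exceptional_demand S F l"
  shows "possibly_efficient S M W l" "no_plateau F \<Longrightarrow> always_efficient S M W l"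
proof -
  let ?D = "l - cap_I S"
  have D: "cap_F S \<le> ?D" "c_F S \<le> mean_price (cap_F S) ?D"
    using assms by (simp_all add: exceptional_demand_iff)
  then have "eq_point (cap_F S) (cap_I S)"
    using params merit_order by (auto simp: eq_point_def in_box_def)
  then show "possibly_efficient S M W l"
    using possibly_efficientI min_point_iff by blast
  assume np: "no_plateau F"
  show "always_efficient S M W l"
  proof (rule always_efficientI)
    fix x y assume eq: "eq_point x y"
    then have box: "0 \<le> x" "x \<le> cap_F S" "y \<le> cap_I S" by (simp_all add: eq_point_def in_box_def)
    have "mean_price (cap_F S) ?D \<le> mean_price (cap_F S) (l - y)"
      using box by (intro mean_price_mono) simp
    also have "\<dots> \<le> mean_price x (l - y)"
      using box by (intro mean_price_antimono)
    finally have "y = cap_I S"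
      using D merit_order eq box by (force simp: eq_point_def)
    have "x = cap_F S"
    proof (rule ccontr)
      assume "x \<noteq> cap_F S"
      then have x: "x < cap_F S" using box by simp
      then have le: "mean_price x ?D \<le> c_F S"
        using eq \<open>y = cap_I S\<close> by (simp add: eq_point_def)
      then have "(c_up S - c_dn S) * F (?D - x) \<le> (c_up S - c_dn S) * F (?D - cap_F S)"
        using D by (simp add: mean_price_def)
      then have F: "F (?D - x) \<le> F (?D - cap_F S)"
        using costs by simp
      then have "F (?D - x) = 0 \<or> F (?D - x) = 1"
        using no_plateauD[OF np, of "?D - cap_F S" "?D - x"] x by simp
      then show False
      proof
        assume "F (?D - x) = 0"
        then show False using F_le_0_iff[of "?D - x"] D x by simp
      next
        assume "F (?D - x) = 1"
        then have "F (?D - cap_F S) = 1" "F ?D = 1"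
          using F F_bounds(2)[of "?D - cap_F S"] F_bounds(2)[of ?D] F_mono[of "?D - x" ?D] box by auto
        then show False
          using le \<open>F (?D - x) = 1\<close> params by (simp add: mean_price_def)
      qed
    qed
    then show "min_point x y" using min_point_iff[OF eq] by blast
  qed
qed

text \<open>For \<open>l \<noteq> 0\<close> demand after inflexible production almost surely exceeds
  stochastic output, so \<open>c_dn = c_F\<close> enters the price in full; below capacity this
  forces \<open>F (l - y - x) = 0\<close>.\<close>

lemma efficient_degenerate:
  assumes "degenerate_demand S F l"
  shows "always_efficient S M W l"
proof (rule always_efficientI)
  fix x y assume eq: "eq_point x y"
  then have box: "0 \<le> x" "x \<le> cap_F S" "0 \<le> y" "y \<le> cap_I S" "y \<le> l"
    by (simp_all add: eq_point_def in_box_def)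
  have "l - y \<le> x" if "x \<noteq> cap_F S" "l \<noteq> 0"
  proof -
    have "F (l - y) = 1"
      using assms that(2) F_mono[of "l - cap_I S" "l - y"] F_bounds(2)[of "l - y"] box
      by (simp add: degenerate_demand_iff)
    moreover have "mean_price x (l - y) \<le> c_F S"
      using eq that(1) box by (simp add: eq_point_def)
    moreover have "0 \<le> (voll S - c_up S) * F (l - y - cap_F S)"
      using params F_bounds by simp
    ultimately have "(c_up S - c_dn S) * F (l - y - x) \<le> 0"
      using costs by (simp add: mean_price_def)
    then show ?thesis
      using costs F_le_0_iff[of "l - y - x"] by (simp add: mult_le_0_iff)
  qed
  then show "min_point x y"
    using min_point_iff[OF eq] box by fastforce
qed

text \<open>An efficient point has flexible forward production, hence \<open>y = cap_I\<close>.
  Outside the exceptional range \<open>?D\<close> is below \<open>cap_F\<close> and at most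
  \<open>x\<close>, so the price is \<open>c_F * F ?D\<close> and \<open>F ?D = 1\<close>, which is
  degenerate demand.\<close>

lemma never_efficient_otherwise:
  assumes "\<not> exceptional_demand S F l" "\<not> degenerate_demand S F l"
  shows "never_efficient S M W l"
proof (rule never_efficientI)
  let ?D = "l - cap_I S"
  fix x y assume eq: "eq_point x y"
  show "\<not> min_point x y"
  proof
    assume "min_point x y"
    then have eff: "x = cap_F S \<or> l - y \<le> x" using min_point_iff[OF eq] by blast
    have "0 < l" using assms demand_nonneg by (auto simp: degenerate_demand_iff)
    then have "0 < x"
      using eff params eq_point_residual_demand[OF eq] by auto
    then have flex: "y = cap_I S" "c_F S \<le> mean_price x ?D"
      using eq_point_flexible[OF eq] by auto
    have x: "x \<le> cap_F S" using eq by (simp add: eq_point_def in_box_def)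
    have D: "?D \<le> x" "?D < cap_F S"
      using eff flex assms(1) x by (cases "x = cap_F S"; auto simp: exceptional_demand_iff)+
    then have "c_F S \<le> c_F S * F ?D"
      using flex F_eq_0[of "?D - x"] F_eq_0[of "?D - cap_F S"] costs by (simp add: mean_price_def)
    then have "F ?D = 1"
      using params F_bounds(2)[of ?D] by simp
    then show False using assms(2) D by (simp add: degenerate_demand_iff)
  qed
qed

end

end

section \<open>From a density to the comparison of the two markets\<close>

theorem corollary5:
  fixes S :: power_system
    and M :: "'a measure"
    and W :: "'a \<Rightarrow> real"
    and f :: "real \<Rightarrow> ennreal"
    and F :: "real \<Rightarrow> real"
    and l :: real
  assumes "valid_power_system S"
    and "prob_space M"
    and "distributed M lborel W f"
    and "\<forall>\<omega>\<in>space M. 0 \<le> W \<omega> \<and> W \<omega> \<le> cap_W S"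
    and "F = cdf (distr M borel W)"
    and "0 \<le> l"
    and "c_I S < c_F S"
  shows
    "(case1 S F l \<or> case3 S F l \<longrightarrow>
        possibly_efficient S M W l \<and>
        (l \<noteq> l5 S F \<or> no_plateau F \<longrightarrow> always_efficient S M W l)) \<and>
     (case2 S F l \<or> case4 S l \<or> case5 S \<longrightarrow> always_efficient S M W l) \<and>
     (c_F S = c_dn S \<and> 0 < c_up S - c_F S \<and> gen_inverse F 0 = 0 \<longrightarrow>
        (exceptional_demand S F l \<longrightarrow>
           possibly_efficient S M W l \<and> (no_plateau F \<longrightarrow> always_efficient S M W l)) \<and>
        (degenerate_demand S F l \<longrightarrow> always_efficient S M W l) \<and>
        (\<not> exceptional_demand S F l \<and> \<not> degenerate_demand S F l \<longrightarrow>
           never_efficient S M W l))"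
proof -
  interpret prob_space M by fact
  have W: "W \<in> borel_measurable M"
    using distributed_measurable[OF assms(3)] by simp
  have f: "f \<in> borel_measurable lborel"
    using distributed_borel_measurable[OF assms(3)] by simp
  have "AE \<omega> in M. W \<omega> \<noteq> t" for t
  proof -
    \<comment> \<open>Single points are Lebesgue null, hence null for any law with a density; this
      gives \<open>atomless\<close>.\<close>
    have "AE s in density lborel f. s \<noteq> t"
      using AE_lborel_singleton[of t] f by (auto simp: AE_density)
    then have "AE s in distr M lborel W. s \<noteq> t"
      unfolding distributed_distr_eq_density[OF assms(3)] .
    then show ?thesis
      using W by (simp add: AE_distr_iff)
  qed
  then interpret market: power_market M S W l
    using assms W by unfold_locales auto
  show ?thesis
    unfolding \<open>F = cdf (distr M borel W)\<close>
    using market.efficient_case1 market.efficient_case2 market.efficient_case3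
      market.efficient_case4 market.efficient_case5 market.efficient_exceptional
      market.efficient_degenerate market.never_efficient_otherwise
    by simp
qed

end
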